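(* Let $p$ be a prime and let $K$ be an infinite field of characteristic $p$. (1) For every $n\geq 1$, the formula $\varphi(x;y_1,\dots,y_n)\colon\ \exists t\; x=y_1\cdots y_n(t^p-t)$ has IP$_n$ (in the theory of $K$ in the language of rings) if and only if $K$ has an Artin–Schreier extension. (2) The formula $\psi(x;y,z)\colon\ \exists t\; x+z=y(t^p-t)$ (object variable $x$, parameter variables $(y,z)$) has TP2 (in the theory of $K$ in the language of rings) if and only if $K$ has infinitely many distinct Artin–Schreier extensions.
   Context: An Artin–Schreier extension of a field $K$ of characteristic $p>0$ is a Galois extension of $K$ of degree $p$, i.e. an extension generated by a root of a polynomial $X^p-X-a$, $a\in K$, without root in $K$. Distinct extensions are counted inside a fixed separable closure. Let $T$ be a complete theory and $\mathbb M\models T$ a monster model. A formula $\varphi(x;y_1,\dots,y_n)$ has the independence property of order $n$ (IP$_n$) if there are $(a^k_i)^{1\leq k\leq n}_{i<\omega}$ and $(b_J)_{J\subseteq\omega^n}$ in $\mathbb M$ such that $\mathbb M\models\varphi(b_J,a^1_{i_1},\dots,a^n_{i_n})$ iff $(i_1,\dots,i_n)\in J$. A formula $\psi(x,y)$ (with $y$ possibly a tuple) has the tree property of the second kind (TP2) if there are $(a_{ij})_{(i,j)\in\omega^2}$ in $\mathbb M$ and $k<\omega$ such that for any $i<\omega$ the set $\{\psi(x,a_{ij}) : j<\omega\}$ is $k$-inconsistent (any $k$ of these formulas are jointly inconsistent), while for any $f\colon\omega\to\omega$ the set $\{\psi(x,a_{if(i)}) : i<\omega\}$ is consistent. *)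

theory Defs
  imports "HOL-Algebra.Algebraic_Closure_Type"
begin

unbundle cardinal_syntax

section \<open>First-order logic in the language of rings\<close>

datatype rterm =
  Var nat | Zero | One | Neg rterm | Add rterm rterm | Mul rterm rterm

datatype rform =
  Eq rterm rterm | Not rform | And rform rform | Ex nat rform

primrec fv_term :: "rterm \<Rightarrow> nat set" where
  "fv_term (Var v) = {v}"
| "fv_term Zero = {}"
| "fv_term One = {}"
| "fv_term (Neg s) = fv_term s"
| "fv_term (Add s t) = fv_term s \<union> fv_term t"
| "fv_term (Mul s t) = fv_term s \<union> fv_term t"

primrec fv :: "rform \<Rightarrow> nat set" where
  "fv (Eq s t) = fv_term s \<union> fv_term t"
| "fv (Not \<phi>) = fv \<phi>"
| "fv (And \<phi> \<psi>) = fv \<phi> \<union> fv \<psi>"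
| "fv (Ex v \<phi>) = fv \<phi> - {v}"

primrec eval_term :: "(nat \<Rightarrow> 'm::ring_1) \<Rightarrow> rterm \<Rightarrow> 'm" where
  "eval_term e (Var v) = e v"
| "eval_term e Zero = 0"
| "eval_term e One = 1"
| "eval_term e (Neg s) = - eval_term e s"
| "eval_term e (Add s t) = eval_term e s + eval_term e t"
| "eval_term e (Mul s t) = eval_term e s * eval_term e t"

primrec sat :: "(nat \<Rightarrow> 'm::ring_1) \<Rightarrow> rform \<Rightarrow> bool" where
  "sat e (Eq s t) \<longleftrightarrow> eval_term e s = eval_term e t"
| "sat e (Not \<phi>) \<longleftrightarrow> \<not> sat e \<phi>"
| "sat e (And \<phi> \<psi>) \<longleftrightarrow> sat e \<phi> \<and> sat e \<psi>"
| "sat e (Ex v \<phi>) \<longleftrightarrow> (\<exists>a. sat (e(v := a)) \<phi>)"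

text \<open>
  \<open>holds \<phi> [a\<^sub>0, \<dots>, a\<^sub>n]\<close> interprets variable \<open>i\<close> by \<open>a\<^sub>i\<close>. The value \<open>0\<close> of the remaining
  variables is irrelevant as long as the free variables of \<open>\<phi>\<close> are among \<open>0, \<dots>, n\<close>.
\<close>
definition holds :: "rform \<Rightarrow> 'm::ring_1 list \<Rightarrow> bool" where
  "holds \<phi> as = sat (\<lambda>v. if v < length as then as ! v else 0) \<phi>"

definition Th :: "'k::ring_1 itself \<Rightarrow> rform set" where
  "Th _ = {\<phi>. fv \<phi> = {} \<and> holds \<phi> ([] :: 'k list)}"

definition models :: "'m::ring_1 itself \<Rightarrow> rform set \<Rightarrow> bool" where
  "models _ T \<longleftrightarrow> (\<forall>\<phi>\<in>T. holds \<phi> ([] :: 'm list))"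

section \<open>Monster models\<close>

text \<open>
  A pair \<open>(\<phi>, as)\<close> stands for the formula \<open>\<phi>(x, as)\<close> in the one variable \<open>x\<close> (variable \<open>0\<close>) with
  parameters \<open>as\<close> from \<open>A\<close> (variables \<open>1, \<dots>, length as\<close>).
\<close>
definition param_forms :: "'m::ring_1 set \<Rightarrow> (rform \<times> 'm list) set" where
  "param_forms A = {(\<phi>, as). set as \<subseteq> A \<and> fv \<phi> \<subseteq> {..length as}}"

definition realised :: "(rform \<times> 'm::ring_1 list) set \<Rightarrow> bool" where
  "realised \<Gamma> \<longleftrightarrow> (\<exists>b. \<forall>(\<phi>, as)\<in>\<Gamma>. holds \<phi> (b # as))"

definition saturated :: "'c rel \<Rightarrow> 'm::ring_1 itself \<Rightarrow> bool" where
  "saturated \<kappa> _ \<longleftrightarrow>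
     (\<forall>A :: 'm set. |A| <o \<kappa> \<longrightarrow>
       (\<forall>\<Gamma> \<subseteq> param_forms A. (\<forall>\<Delta> \<subseteq> \<Gamma>. finite \<Delta> \<longrightarrow> realised \<Delta>) \<longrightarrow> realised \<Gamma>))"

definition elementary_map_on :: "'m::ring_1 set \<Rightarrow> ('m \<Rightarrow> 'm) \<Rightarrow> bool" where
  "elementary_map_on A f \<longleftrightarrow>
     (\<forall>\<phi> as. set as \<subseteq> A \<and> fv \<phi> \<subseteq> {..<length as} \<longrightarrow> holds \<phi> (map f as) = holds \<phi> as)"

definition ring_automorphism :: "('m::ring_1 \<Rightarrow> 'm) \<Rightarrow> bool" where
  "ring_automorphism \<sigma> \<longleftrightarrow>
     bij \<sigma> \<and> \<sigma> 1 = 1 \<and> (\<forall>x y. \<sigma> (x + y) = \<sigma> x + \<sigma> y \<and> \<sigma> (x * y) = \<sigma> x * \<sigma> y)"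

definition strongly_homogeneous :: "'c rel \<Rightarrow> 'm::ring_1 itself \<Rightarrow> bool" where
  "strongly_homogeneous \<kappa> _ \<longleftrightarrow>
     (\<forall>(A :: 'm set) f. |A| <o \<kappa> \<and> elementary_map_on A f \<longrightarrow>
       (\<exists>\<sigma>. ring_automorphism \<sigma> \<and> (\<forall>a\<in>A. \<sigma> a = f a)))"

text \<open>
  Conventions differ on how large \<open>\<kappa>\<close> has to be. Only uncountability is required here (the
  language is countable), so every larger choice is covered.
\<close>
definition monster_model :: "'c rel \<Rightarrow> rform set \<Rightarrow> 'm::ring_1 itself \<Rightarrow> bool" where
  "monster_model \<kappa> T M \<longleftrightarrow>
     Card_order \<kappa> \<and> natLeq <o \<kappa> \<and> models M T \<and> saturated \<kappa> M \<and> strongly_homogeneous \<kappa> M"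

section \<open>The independence property of order \<open>n\<close> and TP2\<close>

text \<open>
  Variable \<open>0\<close> is \<open>x\<close> and variables \<open>1, \<dots>, n\<close> are \<open>y\<^sub>1, \<dots>, y\<^sub>n\<close>. The sequence \<open>a\<^sup>k\<close> is \<open>a (k - 1)\<close>, and
  \<open>\<omega>\<^sup>n\<close> is the set of lists of length \<open>n\<close>.
\<close>
definition has_IP :: "'m::ring_1 itself \<Rightarrow> nat \<Rightarrow> rform \<Rightarrow> bool" where
  "has_IP _ n \<phi> \<longleftrightarrow>
     (\<exists>(a :: nat \<Rightarrow> nat \<Rightarrow> 'm) (b :: nat list set \<Rightarrow> 'm).
        \<forall>J \<subseteq> {is. length is = n}. \<forall>is. length is = n \<longrightarrow>
          (holds \<phi> (b J # map (\<lambda>k. a k (is ! k)) [0..<n]) \<longleftrightarrow> is \<in> J))"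

text \<open>
  The parameter variable \<open>y\<close> is the \<open>m\<close>-tuple of variables \<open>1, \<dots>, m\<close>. Inconsistency of a row
  refers to any \<open>k\<close> distinct indices \<open>j\<close>, not to distinct formulas (rows may not be constant).
\<close>
definition has_TP2 :: "'m::ring_1 itself \<Rightarrow> nat \<Rightarrow> rform \<Rightarrow> bool" where
  "has_TP2 _ m \<psi> \<longleftrightarrow>
     (\<exists>(a :: nat \<Rightarrow> nat \<Rightarrow> 'm list) (k :: nat).
        (\<forall>i j. length (a i j) = m) \<and>
        (\<forall>i S. finite S \<and> card S = k \<longrightarrow> \<not> (\<exists>x. \<forall>j\<in>S. holds \<psi> (x # a i j))) \<and>
        (\<forall>f :: nat \<Rightarrow> nat. \<exists>x. \<forall>i. holds \<psi> (x # a i (f i))))"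

section \<open>The two formulas\<close>

primrec Pow :: "rterm \<Rightarrow> nat \<Rightarrow> rterm" where
  "Pow s 0 = One"
| "Pow s (Suc n) = Mul (Pow s n) s"

primrec prod_vars :: "nat \<Rightarrow> rterm" where
  "prod_vars 0 = One"
| "prod_vars (Suc n) = Mul (prod_vars n) (Var (Suc n))"

definition AS_term :: "nat \<Rightarrow> rterm \<Rightarrow> rterm" where
  "AS_term p t = Add (Pow t p) (Neg t)"

text \<open>\<open>\<exists>t. x = y\<^sub>1 \<cdots> y\<^sub>n (t\<^sup>p - t)\<close>, with variable \<open>n + 1\<close> for \<open>t\<close>\<close>
definition AS_IP_form :: "nat \<Rightarrow> nat \<Rightarrow> rform" where
  "AS_IP_form p n = Ex (n + 1) (Eq (Var 0) (Mul (prod_vars n) (AS_term p (Var (n + 1)))))"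

text \<open>\<open>\<exists>t. x + z = y (t\<^sup>p - t)\<close>, with variables \<open>0, 1, 2, 3\<close> for \<open>x, y, z, t\<close>\<close>
definition AS_TP2_form :: "nat \<Rightarrow> rform" where
  "AS_TP2_form p = Ex 3 (Eq (Add (Var 0) (Var 2)) (Mul (Var 1) (AS_term p (Var 3))))"

section \<open>Artin--Schreier extensions\<close>

text \<open>
  Extensions of the field \<open>'k\<close> are intermediate fields of its algebraic closure
  \<open>'k alg_closure\<close>, into which \<open>'k\<close> embeds by \<open>to_ac\<close>.
\<close>
definition separable_closure :: "'k::field alg_closure set" where
  "separable_closure =
     {\<alpha>. \<exists>f :: 'k poly. irreducible f \<and> rsquarefree (map_poly to_ac f) \<and>
           poly (map_poly to_ac f) \<alpha> = 0}"

definition intermediate_field :: "'k::field alg_closure set \<Rightarrow> bool" where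
  "intermediate_field E \<longleftrightarrow>
     range to_ac \<subseteq> E \<and> (\<forall>x\<in>E. - x \<in> E \<and> inverse x \<in> E) \<and>
     (\<forall>x\<in>E. \<forall>y\<in>E. x + y \<in> E \<and> x * y \<in> E)"

definition normal_extension :: "'k::field alg_closure set \<Rightarrow> bool" where
  "normal_extension E \<longleftrightarrow>
     (\<forall>f :: 'k poly. irreducible f \<longrightarrow> (\<exists>\<alpha>\<in>E. poly (map_poly to_ac f) \<alpha> = 0) \<longrightarrow>
        {\<beta>. poly (map_poly to_ac f) \<beta> = 0} \<subseteq> E)"

definition galois_extension :: "'k::field alg_closure set \<Rightarrow> bool" where
  "galois_extension E \<longleftrightarrow>
     intermediate_field E \<and> E \<subseteq> separable_closure \<and> normal_extension E"

text \<open>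
  The dimension below is \<open>0\<close> for infinite extensions, hence different from the characteristic
  when that is positive.
\<close>
definition extension_degree :: "'k::field alg_closure set \<Rightarrow> nat" where
  "extension_degree E = vector_space.dim (\<lambda>(c :: 'k) x. to_ac c * x) E"

definition artin_schreier_extension :: "'k::field alg_closure set \<Rightarrow> bool" where
  "artin_schreier_extension E \<longleftrightarrow> galois_extension E \<and> extension_degree E = CHAR('k)"

end

(*
  Let wp t = t^p - t. The Artin-Schreier extensions of K correspond to the lines of the F_p-space
  K / wp(K), so it has one iff wp is not onto, and infinitely many iff K / wp(K) is infinite; both
  conditions pass between K and the monster model M.

  By saturation M contains theta, transcendental over F_p, with p^N-th roots for all N. For finitely
  many exponents s and arbitrary targets e_s there is b with b theta^s = e_s mod wp(M): take
  y^(p^N) = theta and use Moore interpolation to find D with L(y^s) = sum_m D_m (y^s)^(p^m) equal to 1 at one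
  exponent and 0 at the others; as x = x^(p^k) mod wp(M), b = sum_m (D_m e)^(p^(N-m)) satisfies
  b theta^s = L(y^s) e mod wp(M). Parameters that are inverses of powers of theta then witness IP_n
  and TP2, by compactness.

  If wp is onto, the first formula only says that x = 0 or all y_i are nonzero. If M / wp(M) is
  finite of size q, the instances of the second one with y nonzero are cosets of density 1/q, so in a
  k-inconsistent row almost all y vanish, and the remaining instances are singletons.
*)
theory Submission
  imports Defs "HOL-Library.Countable_Set" "HOL-Library.Nat_Bijection"
begin

section \<open>Artin--Schreier map and interpolation\<close>

text \<open>\<open>range wp\<close> is closed under addition but in general not under multiplication
  by elements of the field, so the classes of b \<theta>^s cannot be prescribed by linear algebra
  over M. The way out is that Frobenius acts as the identity modulo \<open>range wp\<close>: the
  terms of an additive polynomial may be raised to different p-powers until they share a common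
  factor, at the price of needing p-power roots. K may be algebraic over F_p, and it may lack such
  roots; hence the passage to M, where infinitely many conditions can be met at once. Powers of a
  single \<theta> suffice because distinct powers are independent over F_p, which is exactly what
  Moore interpolation asks for. In the finite case nothing is known about the relative position of
  the groups y_j wp(M), so their cosets need not be jointly equidistributed; averaging uses one
  coordinate at a time and avoids the question. The extensions are defined through normality,
  separability and dimension, with no Galois group in sight. A single endomorphism with fixed field
  K takes the place of a generator of the group, and its orbits take the place of the sets of
  conjugates.\<close>

definition wp :: "'a::field \<Rightarrow> 'a" where
  "wp t = t ^ CHAR('a) - t"

lemma power_char_diff:
  fixes x y :: "'a::comm_ring_1"
  assumes "prime CHAR('a)"
  shows "(x - y) ^ CHAR('a) = x ^ CHAR('a) - y ^ CHAR('a)"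
  using freshmans_dream[OF assms refl, of "x - y" y] by simp

lemma wp_add: "prime CHAR('a) \<Longrightarrow> wp (x + y) = wp x + wp (y :: 'a::field)"
  by (simp add: wp_def freshmans_dream)

lemma wp_diff: "prime CHAR('a) \<Longrightarrow> wp (x - y) = wp x - wp (y :: 'a::field)"
  by (simp add: wp_def power_char_diff)

lemma wp_0 [simp]: "prime CHAR('a) \<Longrightarrow> wp (0 :: 'a::field) = 0"
  using wp_diff[of "0::'a" 0] by simp

lemma wp_1 [simp]: "wp (1 :: 'a::field) = 0"
  by (simp add: wp_def)

lemma wp_of_nat [simp]: "prime CHAR('a) \<Longrightarrow> wp (of_nat n :: 'a::field) = 0"
  by (induction n) (auto simp: wp_add)

lemma of_nat_power_char: "prime CHAR('a) \<Longrightarrow> (of_nat n :: 'a::field) ^ CHAR('a) = of_nat n"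
  using wp_of_nat[of n, where 'a='a] by (simp add: wp_def)

lemma wp_eq_0_iff:
  fixes x :: "'a::field"
  assumes p: "prime CHAR('a)"
  shows "wp x = 0 \<longleftrightarrow> (\<exists>i<CHAR('a). x = of_nat i)"
proof
  define f where "f = monom 1 (CHAR('a)) - [:0, 1 :: 'a:]"
  have p1: "CHAR('a) > 1"
    using p prime_gt_1_nat by blast
  have "coeff f (CHAR('a)) = 1"
    using p1 by (cases "CHAR('a)") (auto simp: f_def coeff_pCons split: nat.split)
  then have f0: "f \<noteq> 0"
    by auto
  have "degree f \<le> CHAR('a)"
    unfolding f_def using p1 by (intro degree_diff_le) (auto intro: degree_monom_le)
  moreover have roots: "{x. poly f x = 0} = {x. wp x = 0}"
    by (auto simp: f_def wp_def poly_monom)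
  ultimately have le: "card {x :: 'a. wp x = 0} \<le> CHAR('a)"
    using card_poly_roots_bound[OF f0] by auto
  have fin: "finite {x :: 'a. wp x = 0}"
    using poly_roots_finite[OF f0] roots by simp
  have sub: "of_nat ` {..<CHAR('a)} \<subseteq> {x :: 'a. wp x = 0}"
    using p by auto
  have inj: "inj_on (of_nat :: nat \<Rightarrow> 'a) {..<CHAR('a)}"
    by (rule linorder_inj_onI) (auto simp: of_nat_eq_iff_char_dvd dest: dvd_imp_le)
  have "of_nat ` {..<CHAR('a)} = {x :: 'a. wp x = 0}"
    by (rule card_seteq[OF fin sub]) (use le in \<open>simp add: card_image[OF inj]\<close>)
  then show "wp x = 0 \<Longrightarrow> \<exists>i<CHAR('a). x = of_nat i"
    by blast
qed (use p in auto)

lemma wp_eq_iff: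
  fixes x :: "'a::field"
  assumes p: "prime CHAR('a)"
  shows "wp x = wp y \<longleftrightarrow> (\<exists>i<CHAR('a). x = y + of_nat i)"
  using wp_eq_0_iff[OF p, of "x - y"] by (auto simp: wp_diff[OF p] algebra_simps)

lemma range_wp_add: "prime CHAR('a) \<Longrightarrow> x \<in> range wp \<Longrightarrow> y \<in> range wp \<Longrightarrow> x + (y :: 'a::field) \<in> range wp"
  by (metis (no_types, lifting) rangeE rangeI wp_add)

lemma range_wp_diff: "prime CHAR('a) \<Longrightarrow> x \<in> range wp \<Longrightarrow> y \<in> range wp \<Longrightarrow> x - (y :: 'a::field) \<in> range wp"
  by (metis (no_types, lifting) rangeE rangeI wp_diff)

lemma range_wp_0: "prime CHAR('a) \<Longrightarrow> (0 :: 'a::field) \<in> range wp"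
  by (metis rangeI wp_0)

lemma range_wp_minus: "prime CHAR('a) \<Longrightarrow> x \<in> range wp \<Longrightarrow> - (x :: 'a::field) \<in> range wp"
  using range_wp_diff[of 0 x] range_wp_0 by auto

lemma range_wp_sum:
  "prime CHAR('a) \<Longrightarrow> (\<And>i. i \<in> I \<Longrightarrow> f i \<in> range wp) \<Longrightarrow> sum f I \<in> range (wp :: 'a::field \<Rightarrow> 'a)"
  by (induction I rule: infinite_finite_induct) (auto simp: range_wp_0 range_wp_add)

lemma power_char_power_diff_in_range_wp:
  "prime CHAR('a) \<Longrightarrow> (x :: 'a::field) ^ (CHAR('a) ^ m) - x \<in> range wp"
proof (induction m)
  case (Suc m)
  have "wp (x ^ (CHAR('a) ^ m)) + (x ^ (CHAR('a) ^ m) - x) \<in> range wp"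
    using Suc by (intro range_wp_add) auto
  then show ?case
    by (simp add: wp_def mult.commute flip: power_mult)
qed (simp add: range_wp_0)

section \<open>Counting cosets modulo the image of the Artin-Schreier map\<close>

definition wp_rep :: "'a::field \<Rightarrow> 'a" where
  "wp_rep x = (SOME y. x - y \<in> range wp)"

lemma wp_rep_diff: "prime CHAR('a) \<Longrightarrow> x - wp_rep x \<in> range (wp :: 'a::field \<Rightarrow> 'a)"
  unfolding wp_rep_def by (rule someI[of _ x]) (simp add: range_wp_0)

text \<open>The predicate under \<open>SOME\<close> depends only on the class of its argument, hence
  so does the choice. Thus \<open>range wp_rep\<close> is a system of representatives and stands for
  the quotient K / wp(K) when its size is needed.\<close>

lemma wp_rep_eq_iff:
  fixes x y :: "'a::field"
  assumes p: "prime CHAR('a)"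
  shows "wp_rep x = wp_rep y \<longleftrightarrow> x - y \<in> range wp"
proof
  assume "wp_rep x = wp_rep y"
  then show "x - y \<in> range wp"
    using range_wp_diff[OF p wp_rep_diff[OF p, of x] wp_rep_diff[OF p, of y]] by simp
next
  assume xy: "x - y \<in> range wp"
  have "x - z \<in> range wp \<longleftrightarrow> y - z \<in> range wp" for z
    using range_wp_diff[OF p _ xy, of "x - z"] range_wp_add[OF p _ xy, of "y - z"] by auto
  then show "wp_rep x = wp_rep y"
    by (simp add: wp_rep_def)
qed

lemma wp_rep_add_wp_rep:
  fixes x y :: "'a::field"
  assumes p: "prime CHAR('a)"
  shows "wp_rep (wp_rep x + y) = wp_rep (x + y)"
  using range_wp_minus[OF p wp_rep_diff[OF p, of x]] by (simp add: wp_rep_eq_iff[OF p])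

lemma wp_rep_wp_rep [simp]: "prime CHAR('a) \<Longrightarrow> wp_rep (wp_rep x) = wp_rep (x :: 'a::field)"
  using wp_rep_add_wp_rep[of x 0] by simp

text \<open>
  The group of all classes \<open>(x / y\<^sub>j mod range wp)\<^sub>j\<close> projects onto every coordinate with fibres of equal
  size, so the cosets of the groups \<open>y\<^sub>j wp(K)\<close> all have density \<open>1 / |K / wp(K)|\<close> and some point lies in
  an average number of them.
\<close>
lemma exists_point_in_many_cosets:
  fixes y z :: "'i \<Rightarrow> 'a::field"
  assumes p: "prime CHAR('a)" and fin: "finite (range (wp_rep :: 'a \<Rightarrow> 'a))"
    and J: "finite J" and y: "\<And>j. j \<in> J \<Longrightarrow> y j \<noteq> 0"
  shows "\<exists>x. card J \<le> card (range (wp_rep :: 'a \<Rightarrow> 'a)) * card {j \<in> J. x / y j - z j \<in> range wp}"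
proof -
  define R where "R = range (wp_rep :: 'a \<Rightarrow> 'a)"
  define \<Phi> where "\<Phi> x = (\<lambda>j\<in>J. wp_rep (x / y j))" for x
  define \<Omega> where "\<Omega> = range \<Phi>"
  have "\<Omega> \<subseteq> (\<Pi>\<^sub>E j\<in>J. R)"
    by (auto simp: \<Omega>_def \<Phi>_def R_def)
  then have fin\<Omega>: "finite \<Omega>"
    using finite_PiE[OF J, of "\<lambda>_. R"] fin by (simp add: R_def finite_subset)
  have \<Omega>0: "card \<Omega> > 0"
    using fin\<Omega> by (simp add: card_gt_0_iff \<Omega>_def)
  \<comment> \<open>Translation by \<open>a\<close>, seen on tuples of classes. It permutes
    \<Omega>, and this invariance is what equalises the fibres of one coordinate.\<close>
  define T where "T a \<omega> = (\<lambda>j\<in>J. wp_rep (\<omega> j + a / y j))" for a and \<omega> :: "'i \<Rightarrow> 'a"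
  have T\<Phi>: "T a (\<Phi> x) = \<Phi> (x + a)" for a x
    by (auto simp: T_def \<Phi>_def wp_rep_add_wp_rep[OF p] add_divide_distrib intro!: restrict_ext)
  have inj: "inj_on (T a) \<Omega>" for a
  proof (rule inj_on_inverseI)
    show "T (- a) (T a \<omega>) = \<omega>" if "\<omega> \<in> \<Omega>" for \<omega>
      using that by (auto simp: \<Omega>_def T\<Phi>)
  qed
  have fibre_le: "card {\<omega> \<in> \<Omega>. \<omega> j = r} \<le> card {\<omega> \<in> \<Omega>. \<omega> j = r'}"
    if "j \<in> J" "r \<in> R" "r' \<in> R" for j r r'
  proof (rule card_inj_on_le)
    \<comment> \<open>Divided by \<open>y j\<close>, this shift becomes \<open>r' - r\<close>, so it
      moves coordinate \<open>j\<close> from the class of \<open>r\<close> to that of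
      \<open>r'\<close>.\<close>
    show "inj_on (T (y j * (r' - r))) {\<omega> \<in> \<Omega>. \<omega> j = r}"
      using inj by (rule inj_on_subset) auto
    have "T (y j * (r' - r)) \<omega> j = r'" if "\<omega> j = r" for \<omega>
      using that \<open>j \<in> J\<close> \<open>r' \<in> R\<close> y p by (auto simp: T_def R_def)
    then show "T (y j * (r' - r)) ` {\<omega> \<in> \<Omega>. \<omega> j = r} \<subseteq> {\<omega> \<in> \<Omega>. \<omega> j = r'}"
      by (auto simp: \<Omega>_def T\<Phi>)
  qed (use fin\<Omega> in auto)
  have fibre: "card R * card {\<omega> \<in> \<Omega>. \<omega> j = r} = card \<Omega>" if j: "j \<in> J" and r: "r \<in> R" for j r
  proof -
    have "card \<Omega> = card (\<Union>r'\<in>R. {\<omega> \<in> \<Omega>. \<omega> j = r'})"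
      using j by (intro arg_cong[of _ _ card]) (auto simp: \<Omega>_def \<Phi>_def R_def)
    also have "\<dots> = (\<Sum>r'\<in>R. card {\<omega> \<in> \<Omega>. \<omega> j = r'})"
      using fin fin\<Omega> by (intro card_UN_disjoint) (auto simp: R_def)
    also have "\<dots> = (\<Sum>r'\<in>R. card {\<omega> \<in> \<Omega>. \<omega> j = r})"
      using fibre_le j r by (intro sum.cong refl antisym) auto
    finally show ?thesis
      by simp
  qed
  define s where "s j = wp_rep (z j)" for j
  define c where "c \<omega> = card {j \<in> J. \<omega> j = s j}" for \<omega>
  \<comment> \<open>Incidences between indices and points of \<Omega> are counted in two ways; some
    point then does at least as well as the average.\<close>
  have "card J * card \<Omega> = (\<Sum>j\<in>J. card R * card {\<omega> \<in> \<Omega>. \<omega> j = s j})"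
    using fibre by (simp add: s_def R_def)
  also have "\<dots> = card R * (\<Sum>j\<in>J. \<Sum>\<omega>\<in>\<Omega>. if \<omega> j = s j then 1 else 0)"
    using fin\<Omega> by (simp add: sum_distrib_left sum.If_cases Int_def)
  also have "\<dots> = card R * (\<Sum>\<omega>\<in>\<Omega>. c \<omega>)"
    unfolding c_def using J by (subst sum.swap) (simp add: sum.If_cases Int_def)
  finally have eq: "card J * card \<Omega> = (\<Sum>\<omega>\<in>\<Omega>. card R * c \<omega>)"
    by (simp add: sum_distrib_left)
  have "\<exists>\<omega>\<in>\<Omega>. card J \<le> card R * c \<omega>"
  proof (rule ccontr)
    assume "\<not> ?thesis"
    then have "(\<Sum>\<omega>\<in>\<Omega>. card R * c \<omega>) < (\<Sum>\<omega>\<in>\<Omega>. card J)"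
      using fin\<Omega> \<Omega>0 by (intro sum_strict_mono) (auto simp: not_le)
    then show False
      using eq by (simp add: mult.commute)
  qed
  then obtain x where x: "card J \<le> card R * c (\<Phi> x)"
    by (auto simp: \<Omega>_def)
  moreover have "{j \<in> J. \<Phi> x j = s j} = {j \<in> J. x / y j - z j \<in> range wp}"
    by (auto simp: \<Phi>_def s_def wp_rep_eq_iff[OF p])
  ultimately show ?thesis
    unfolding c_def R_def by (intro exI[of _ x]) simp
qed

section \<open>Moore interpolation by additive polynomials\<close>

lemma power_char_eq_mult_iff:
  fixes u w :: "'a::field"
  assumes p: "prime CHAR('a)"
  shows "u ^ CHAR('a) = w ^ (CHAR('a) - 1) * u \<longleftrightarrow> (\<exists>i<CHAR('a). u = of_nat i * w)"
\<comment> \<open>For nonzero \<open>w\<close> this is \<open>wp (u / w) = 0\<close> with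
  denominators cleared. The value \<open>w = 0\<close> occurs in the kernel construction when the
  next vector already lies in the span of the previous ones.\<close>
proof (cases "w = 0")
  case True
  then show ?thesis
    using prime_gt_1_nat[OF p] by (auto simp: power_0_left)
next
  case False
  have w: "w ^ CHAR('a) = w ^ (CHAR('a) - 1) * w"
    using prime_gt_1_nat[OF p] by (metis mult.commute power_minus_mult prime_gt_0_nat p)
  have "u ^ CHAR('a) = w ^ (CHAR('a) - 1) * u \<longleftrightarrow> wp (u / w) = 0"
    using False by (simp add: wp_def power_divide w field_simps)
  also have "\<dots> \<longleftrightarrow> (\<exists>i<CHAR('a). u = of_nat i * w)"
    using False by (simp add: wp_eq_0_iff[OF p] field_simps)
  finally show ?thesis .
qed

text \<open>
  Inductively, if \<open>L\<close> has kernel the \<open>\<F>\<^sub>p\<close>-span of the first vectors, and \<open>w\<close> is its value at the next one,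
  then \<open>L\<^sup>p - w\<^bsup>p-1\<^esup> L\<close> has the right kernel.
\<close>
lemma exists_additive_polynomial_with_kernel:
  fixes g :: "'i \<Rightarrow> 'a::field"
  assumes p: "prime CHAR('a)" and "finite S"
  shows "\<exists>D :: nat \<Rightarrow> 'a. (\<forall>m>card S. D m = 0) \<and>
           (\<forall>x. (\<Sum>m\<le>card S. D m * x ^ (CHAR('a) ^ m)) = 0 \<longleftrightarrow>
                (\<exists>c. x = (\<Sum>s\<in>S. of_nat (c s) * g s)))"
  using \<open>finite S\<close>
proof induction
  case empty
  show ?case
    by (rule exI[of _ "\<lambda>m. if m = 0 then 1 else 0"]) auto
next
  case (insert s S)
  then obtain D where D0: "\<And>m. m > card S \<Longrightarrow> D m = 0"
    and D: "\<And>x. (\<Sum>m\<le>card S. D m * x ^ (CHAR('a) ^ m)) = 0 \<longleftrightarrow>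
                (\<exists>c. x = (\<Sum>s\<in>S. of_nat (c s) * g s))"
    by auto
  define L where "L x = (\<Sum>m\<le>card S. D m * x ^ (CHAR('a) ^ m))" for x
  have L_diff: "L (x - of_nat i * y) = L x - of_nat i * L y" for x y i
  proof (induction i)
    case (Suc i)
    have L_diff1: "L (x - y) = L x - L y" for x y
    proof -
      have "L ((x - y) + y) = L (x - y) + L y"
        unfolding L_def
        by (subst freshmans_dream'[OF p refl]) (simp add: algebra_simps sum.distrib)
      then show ?thesis
        by simp
    qed
    have "L (x - of_nat (Suc i) * y) = L ((x - of_nat i * y) - y)"
      by (simp add: algebra_simps)
    also have "\<dots> = L x - of_nat (Suc i) * L y"
      unfolding L_diff1[of "x - of_nat i * y" y] Suc by (simp add: algebra_simps)
    finally show ?case .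
  qed simp
  define w where "w = L (g s)"
  \<comment> \<open>The coefficients of L^p - w^(p-1) L: Frobenius moves the coefficient of index
    \<open>k\<close>, raised to the p-th power, to index \<open>Suc k\<close>.\<close>
  define D' where "D' m = (case m of 0 \<Rightarrow> 0 | Suc k \<Rightarrow> D k ^ CHAR('a)) - w ^ (CHAR('a) - 1) * D m" for m
  have "(\<Sum>m\<le>card (insert s S). D' m * x ^ (CHAR('a) ^ m)) = L x ^ CHAR('a) - w ^ (CHAR('a) - 1) * L x" for x
  proof -
    have "L x ^ CHAR('a) = (\<Sum>m\<le>card S. D m ^ CHAR('a) * x ^ (CHAR('a) ^ Suc m))"
      unfolding L_def by (subst freshmans_dream_sum[OF p refl])
        (simp add: power_mult_distrib mult.commute flip: power_mult)
    also have "\<dots> = (\<Sum>m\<le>Suc (card S). (case m of 0 \<Rightarrow> 0 | Suc k \<Rightarrow> D k ^ CHAR('a)) * x ^ (CHAR('a) ^ m))"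
      by (subst sum.atMost_Suc_shift) simp
    finally have 1: "L x ^ CHAR('a) = \<dots>" .
    \<comment> \<open>Here the vanishing of \<open>D\<close> above \<open>card S\<close> enters: it
      lets this sum run one index further, over the same range as the shifted one.\<close>
    have 2: "L x = (\<Sum>m\<le>Suc (card S). D m * x ^ (CHAR('a) ^ m))"
      by (simp add: L_def D0)
    have "card (insert s S) = Suc (card S)"
      using insert by simp
    then show ?thesis
      unfolding 1 by (subst 2) (simp only: D'_def left_diff_distrib sum_subtractf sum_distrib_left mult.assoc)
  qed
  moreover have "L x ^ CHAR('a) - w ^ (CHAR('a) - 1) * L x = 0 \<longleftrightarrow>
      (\<exists>c. x = (\<Sum>s\<in>insert s S. of_nat (c s) * g s))" for x
  proof -
    have "L x ^ CHAR('a) - w ^ (CHAR('a) - 1) * L x = 0 \<longleftrightarrow> (\<exists>i<CHAR('a). L (x - of_nat i * g s) = 0)"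
      unfolding right_minus_eq power_char_eq_mult_iff[OF p] L_diff w_def ..
    also have "\<dots> \<longleftrightarrow> (\<exists>i. L (x - of_nat i * g s) = 0)"
    proof
      assume "\<exists>i. L (x - of_nat i * g s) = 0"
      then obtain i where i: "L (x - of_nat i * g s) = 0" ..
      have "(of_nat i :: 'a) = of_nat (i mod CHAR('a) + CHAR('a) * (i div CHAR('a)))"
        by simp
      also have "\<dots> = of_nat (i mod CHAR('a))"
        by (simp only: of_nat_add of_nat_mult of_nat_CHAR) simp
      finally have "(of_nat (i mod CHAR('a)) :: 'a) = of_nat i" ..
      with i have "L (x - of_nat (i mod CHAR('a)) * g s) = 0"
        by simp
      moreover have "i mod CHAR('a) < CHAR('a)"
        using p by (simp add: prime_gt_0_nat)
      ultimately show "\<exists>i<CHAR('a). L (x - of_nat i * g s) = 0"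
        by blast
    qed auto
    also have "\<dots> \<longleftrightarrow> (\<exists>c. x = (\<Sum>s\<in>insert s S. of_nat (c s) * g s))"
    proof
      assume "\<exists>i. L (x - of_nat i * g s) = 0"
      then obtain i c where "x - of_nat i * g s = (\<Sum>s\<in>S. of_nat (c s) * g s)"
        using D unfolding L_def by metis
      moreover have "(\<Sum>t\<in>S. of_nat ((c(s := i)) t) * g t) = (\<Sum>s\<in>S. of_nat (c s) * g s)"
        using insert by (intro sum.cong) auto
      ultimately have "x = (\<Sum>t\<in>insert s S. of_nat ((c(s := i)) t) * g t)"
        using insert by (simp add: algebra_simps)
      then show "\<exists>c. x = (\<Sum>s\<in>insert s S. of_nat (c s) * g s)"
        by blast
    next
      assume "\<exists>c. x = (\<Sum>s\<in>insert s S. of_nat (c s) * g s)"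
      then obtain c where "x = (\<Sum>s\<in>insert s S. of_nat (c s) * g s)" ..
      then have "x - of_nat (c s) * g s = (\<Sum>s\<in>S. of_nat (c s) * g s)"
        using insert by simp
      then show "\<exists>i. L (x - of_nat i * g s) = 0"
        using D unfolding L_def by metis
    qed
    finally show ?thesis .
  qed
  moreover have "D' m = 0" if "m > card (insert s S)" for m
    using that insert D0 prime_gt_0_nat[OF p] by (cases m) (auto simp: D'_def power_0_left)
  ultimately show ?case
    by (intro exI[of _ D']) auto
qed

text \<open>In positive characteristic \<open>range of_nat\<close> is the prime field, so the second
  clause is transcendence over F_p. Both clauses amount to countably many formulas without
  parameters, the shape that saturation can handle.\<close>

definition generic :: "'a::field \<Rightarrow> bool" where
  "generic \<theta> \<longleftrightarrow> (\<forall>N. \<exists>y. y ^ (CHAR('a) ^ N) = \<theta>) \<and>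
     (\<forall>f. f \<noteq> 0 \<and> (\<forall>i. coeff f i \<in> range of_nat) \<longrightarrow> poly f \<theta> \<noteq> 0)"

lemma of_nat_power_char_power:
  "prime CHAR('a) \<Longrightarrow> (of_nat n :: 'a::field) ^ (CHAR('a) ^ N) = of_nat n"
  by (induction N) (auto simp: power_mult of_nat_power_char)

lemma generic_nonzero: 
  assumes "generic (\<theta> :: 'a::field)"
  shows "\<theta> \<noteq> 0"
proof -
  have "coeff [:0, 1 :: 'a:] i \<in> range of_nat" for i
    by (auto simp: coeff_pCons split: nat.split intro: range_eqI[of _ _ 0] range_eqI[of _ _ 1])
  then have "poly [:0, 1:] \<theta> \<noteq> 0"
    using assms unfolding generic_def by (metis pCons_eq_0_iff zero_neq_one)
  then show ?thesis
    by simp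
qed

lemma generic_powers_independent:
  fixes \<theta> :: "'a::field"
  assumes p: "prime CHAR('a)" and \<theta>: "generic \<theta>" and S: "finite S" "s0 \<notin> S"
  shows "\<theta> ^ s0 \<noteq> (\<Sum>s\<in>S. of_nat (c s) * \<theta> ^ s)"
proof
  assume eq: "\<theta> ^ s0 = (\<Sum>s\<in>S. of_nat (c s) * \<theta> ^ s)"
  \<comment> \<open>The factor \<open>CHAR('a) - 1\<close> is -1 in the field; it keeps all
    coefficients of the form \<open>of_nat\<close>. The coefficient 1 at \<open>s0\<close> makes the
    polynomial nonzero.\<close>
  define f where "f = monom 1 s0 + (\<Sum>s\<in>S. monom (of_nat ((CHAR('a) - 1) * c s)) s :: 'a poly)"
  have "coeff f i = of_nat ((if i = s0 then 1 else 0) + (if i \<in> S then (CHAR('a) - 1) * c i else 0))" for i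
    using S by (simp add: f_def coeff_sum)
  then have 1: "\<And>i. coeff f i \<in> range of_nat" and "coeff f s0 = 1"
    using S by (auto simp del: of_nat_add of_nat_mult of_nat_diff)
  then have "f \<noteq> 0"
    by auto
  with 1 have "poly f \<theta> \<noteq> 0"
    using \<theta> by (auto simp: generic_def)
  moreover have "of_nat ((CHAR('a) - 1) * c s) = - (of_nat (c s) :: 'a)" for s
    using p by (simp add: of_nat_diff prime_ge_Suc_0_nat)
  then have "poly f \<theta> = 0"
    by (simp add: f_def poly_sum poly_monom eq sum_negf)
  ultimately show False
    by contradiction
qed

lemma wp_interpolation_single:
  fixes \<theta> :: "'a::field"
  assumes p: "prime CHAR('a)" and \<theta>: "generic \<theta>" and S: "finite S" "s0 \<notin> S"
  shows "\<exists>b. b * \<theta> ^ s0 - e \<in> range wp \<and> (\<forall>s\<in>S. b * \<theta> ^ s \<in> range wp)"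
proof -
  define q where "q = CHAR('a)"
  define N where "N = card S"
  \<comment> \<open>The polynomial \<open>L\<close> for \<open>card S\<close> vectors involves
    Frobenius powers up to \<open>N = card S\<close>, which fixes the order of the root.\<close>
  obtain y where y: "y ^ (q ^ N) = \<theta>"
    using \<theta> unfolding generic_def q_def by blast
  obtain D :: "nat \<Rightarrow> 'a" where D: "\<And>x. (\<Sum>m\<le>N. D m * x ^ (q ^ m)) = 0 \<longleftrightarrow>
                (\<exists>c. x = (\<Sum>s\<in>S. of_nat (c s) * y ^ s))"
    using exists_additive_polynomial_with_kernel[OF p S(1), of "\<lambda>s. y ^ s"]
    unfolding N_def q_def by metis
  define L where "L x = (\<Sum>m\<le>N. D m * x ^ (q ^ m))" for x
  have L_S: "L (y ^ s) = 0" if "s \<in> S" for s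
    unfolding L_def D
    by (rule exI[of _ "\<lambda>t. if t = s then 1 else 0"]) (use S that in \<open>simp add: if_distrib [of of_nat] if_distrib [of "\<lambda>x. x * _"] cong: if_cong\<close>)
  have L_s0: "L (y ^ s0) \<noteq> 0"
  proof
    assume "L (y ^ s0) = 0"
    then obtain c where "y ^ s0 = (\<Sum>s\<in>S. of_nat (c s) * y ^ s)"
      by (auto simp: L_def D)
    \<comment> \<open>Raising to the power \<open>q ^ N\<close> fixes the coefficients from the
      prime field, so a dependence among powers of \<open>y\<close> would become one among powers of
      \<theta>.\<close>
    then have "(y ^ s0) ^ (q ^ N) = (\<Sum>s\<in>S. of_nat (c s) * y ^ s) ^ (q ^ N)"
      by simp
    also have "\<dots> = (\<Sum>s\<in>S. of_nat (c s) * (y ^ s) ^ (q ^ N))"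
      unfolding q_def
      by (subst freshmans_dream_sum'[OF p refl]) (simp add: power_mult_distrib of_nat_power_char_power[OF p])
    finally have "\<theta> ^ s0 = (\<Sum>s\<in>S. of_nat (c s) * \<theta> ^ s)"
      by (simp add: mult.commute flip: y power_mult)
    then show False
      using generic_powers_independent[OF p \<theta> S] by blast
  qed
  define e' where "e' = e / L (y ^ s0)"
  define b where "b = (\<Sum>m\<le>N. (D m * e') ^ (q ^ (N - m)))"
  have key: "b * \<theta> ^ s - e' * L (y ^ s) \<in> range wp" for s
  proof -
    \<comment> \<open>The exponents \<open>q ^ m\<close> and \<open>q ^ (N - m)\<close> multiply to
      \<open>q ^ N\<close> for every \<open>m\<close>, so each term acquires the same factor
      \<theta>^s, which can then be taken out of the sum.\<close>
    have "(D m * e') ^ (q ^ (N - m)) * \<theta> ^ s = (D m * e' * (y ^ s) ^ (q ^ m)) ^ (q ^ (N - m))"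
      if "m \<le> N" for m
    proof -
      have "q ^ m * q ^ (N - m) = q ^ N"
        using that by (simp flip: power_add)
      then have "((y ^ s) ^ (q ^ m)) ^ (q ^ (N - m)) = y ^ (s * q ^ N)"
        by (simp only: power_mult [symmetric] mult.assoc)
      also have "\<dots> = \<theta> ^ s"
        by (simp only: y [symmetric] power_mult [symmetric] mult.commute)
      finally have "((y ^ s) ^ (q ^ m)) ^ (q ^ (N - m)) = \<theta> ^ s" .
      then show ?thesis
        by (simp add: power_mult_distrib)
    qed
    then have "b * \<theta> ^ s - e' * L (y ^ s) =
        (\<Sum>m\<le>N. (D m * e' * (y ^ s) ^ (q ^ m)) ^ (q ^ (N - m)) - D m * e' * (y ^ s) ^ (q ^ m))"
      by (simp add: b_def L_def sum_distrib_left sum_distrib_right sum_subtractf mult_ac)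
    then show ?thesis
      unfolding q_def
      using power_char_power_diff_in_range_wp[OF p] by (auto intro!: range_wp_sum[OF p])
  qed
  have "b * \<theta> ^ s0 - e \<in> range wp"
    using key[of s0] L_s0 by (simp add: e'_def)
  moreover have "b * \<theta> ^ s \<in> range wp" if "s \<in> S" for s
    using key[of s] L_S[OF that] by simp
  ultimately show ?thesis
    by blast
qed

text \<open>Since \<open>range wp\<close> is a group, solutions that hit one target and vanish at
  the other exponents can be added up, as in Lagrange interpolation.\<close>

lemma wp_interpolation:
  fixes \<theta> :: "'a::field"
  assumes p: "prime CHAR('a)" and \<theta>: "generic \<theta>" and S: "finite S"
  shows "\<exists>b. \<forall>s\<in>S. b * \<theta> ^ s - e s \<in> range wp"
proof -
  have "\<exists>b. b * \<theta> ^ r - e r \<in> range wp \<and> (\<forall>s\<in>S - {r}. b * \<theta> ^ s \<in> range wp)" for r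
    using wp_interpolation_single[OF p \<theta>, of "S - {r}" r "e r"] S by auto
  then obtain b where b: "\<And>r. b r * \<theta> ^ r - e r \<in> range wp"
    "\<And>r s. s \<in> S - {r} \<Longrightarrow> b r * \<theta> ^ s \<in> range wp"
    by metis
  have "(\<Sum>r\<in>S. b r) * \<theta> ^ s - e s \<in> range wp" if s: "s \<in> S" for s
  proof -
    have "(\<Sum>r\<in>S. b r) * \<theta> ^ s - e s = (b s * \<theta> ^ s - e s) + (\<Sum>r\<in>S - {s}. b r * \<theta> ^ s)"
      using S s by (simp add: sum_distrib_right sum.remove distrib_right)
    also have "\<dots> \<in> range wp"
      using b s by (intro range_wp_add[OF p] range_wp_sum[OF p]) auto
    finally show ?thesis .
  qed
  then show ?thesis
    by blast
qed

section \<open>Model theory of the two formulas\<close>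

lemma models_Th_holds_iff:
  assumes "models TYPE('m::ring_1) (Th TYPE('k::ring_1))" "fv \<phi> = {}"
  shows "holds \<phi> ([] :: 'm list) \<longleftrightarrow> holds \<phi> ([] :: 'k list)"
proof -
  have "holds \<phi> ([] :: 'm list)" if "holds \<phi> ([] :: 'k list)" "fv \<phi> = {}" for \<phi>
    using assms(1) that by (auto simp: models_def Th_def)
  from this[of \<phi>] this[of "Not \<phi>"] assms(2) show ?thesis
    by (auto simp: holds_def)
qed

text \<open>The form in which saturation is applied: a countable parameter set is smaller than the
  uncountable \<kappa>. Indexing the formulas by \<open>I\<close> lets finite satisfiability be
  checked on finite index sets.\<close>

lemma saturated_countable:
  fixes as :: "'i \<Rightarrow> 'm::ring_1 list" and \<kappa> :: "'c rel"
  assumes sat: "saturated \<kappa> TYPE('m)" and \<kappa>: "natLeq <o \<kappa>"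
    and countable: "countable (\<Union>i\<in>I. set (as i))"
    and fv: "\<And>i. i \<in> I \<Longrightarrow> fv (\<phi> i) \<subseteq> {..length (as i)}"
    and fin: "\<And>J. finite J \<Longrightarrow> J \<subseteq> I \<Longrightarrow> \<exists>b. \<forall>i\<in>J. holds (\<phi> i) (b # as i)"
  shows "\<exists>b. \<forall>i\<in>I. holds (\<phi> i) (b # as i)"
proof -
  define A where "A = (\<Union>i\<in>I. set (as i))"
  define \<Gamma> where "\<Gamma> = (\<lambda>i. (\<phi> i, as i)) ` I"
  from countable obtain f :: "'m \<Rightarrow> nat" where "inj_on f A"
    unfolding A_def by (rule countableE)
  then have "|A| \<le>o |UNIV :: nat set|"
    using card_of_ordLeq[of A "UNIV :: nat set"] by auto
  then have "|A| \<le>o natLeq"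
    using card_of_nat ordLeq_ordIso_trans by blast
  then have "|A| <o \<kappa>"
    using \<kappa> ordLeq_ordLess_trans by blast
  moreover have "\<Gamma> \<subseteq> param_forms A"
    using fv by (auto simp: \<Gamma>_def param_forms_def A_def)
  moreover have "realised \<Delta>" if "\<Delta> \<subseteq> \<Gamma>" "finite \<Delta>" for \<Delta>
  proof -
    obtain J where "J \<subseteq> I" "finite J" "\<Delta> = (\<lambda>i. (\<phi> i, as i)) ` J"
      using finite_subset_image[OF \<open>finite \<Delta>\<close>] \<open>\<Delta> \<subseteq> \<Gamma>\<close> unfolding \<Gamma>_def by metis
    then show ?thesis
      using fin[of J] by (auto simp: realised_def)
  qed
  ultimately have "realised \<Gamma>"
    using sat unfolding saturated_def by blast
  then show ?thesis
    by (auto simp: realised_def \<Gamma>_def)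
qed

lemma eval_Pow [simp]: "eval_term e (Pow s n) = eval_term e s ^ n"
  by (induction n) (simp_all add: power_commutes)

lemma fv_Pow: "fv_term (Pow s n) \<subseteq> fv_term s"
  by (induction n) auto

lemma eval_prod_vars [simp]:
  "eval_term e (prod_vars n) = (\<Prod>k<n. e (Suc k) :: 'm::comm_ring_1)"
  by (induction n) auto

lemma fv_prod_vars: "fv_term (prod_vars n) \<subseteq> {..n}"
  by (induction n) auto

lemma eval_AS_term [simp]: "eval_term e (AS_term p t) = eval_term e t ^ p - eval_term e t"
  by (simp add: AS_term_def)

lemma fv_AS_term: "fv_term (AS_term p t) \<subseteq> fv_term t"
  using fv_Pow by (auto simp: AS_term_def)

lemma fv_AS_IP_form: "fv (AS_IP_form p n) \<subseteq> {..n}"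
  using fv_prod_vars[of n] fv_AS_term[of p "Var (Suc n)"] by (auto simp: AS_IP_form_def)

lemma fv_AS_TP2_form: "fv (AS_TP2_form p) \<subseteq> {..2}"
  using fv_AS_term[of p "Var 3"] by (auto simp: AS_TP2_form_def)

lemma holds_AS_IP_form:
  fixes x :: "'m::field"
  assumes "length ys = n"
  shows "holds (AS_IP_form CHAR('m) n) (x # ys) \<longleftrightarrow> (\<exists>t. x = (\<Prod>k<n. ys ! k) * wp t)"
  using assms by (simp add: holds_def AS_IP_form_def wp_def)

lemma holds_AS_TP2_form:
  fixes x :: "'m::field"
  shows "holds (AS_TP2_form CHAR('m)) [x, y, z] \<longleftrightarrow> (\<exists>t. x + z = y * wp t)"
  by (simp add: holds_def AS_TP2_form_def wp_def)

section \<open>Transfer between K and M of lower bounds on numbers of classes\<close>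

primrec Exs :: "nat \<Rightarrow> rform \<Rightarrow> rform" where
  "Exs 0 \<phi> = \<phi>"
| "Exs (Suc n) \<phi> = Exs n (Ex n \<phi>)"

lemma sat_Exs: "sat e (Exs n \<phi>) \<longleftrightarrow> (\<exists>a. sat (\<lambda>v. if v < n then a v else e v) \<phi>)"
proof (induction n arbitrary: \<phi>)
  case (Suc n)
  have "(\<exists>a b. sat ((\<lambda>v. if v < n then a v else e v)(n := b)) \<phi>) \<longleftrightarrow>
        (\<exists>a. sat (\<lambda>v. if v < Suc n then a v else e v) \<phi>)"
  proof safe
    fix a b assume "sat ((\<lambda>v. if v < n then a v else e v)(n := b)) \<phi>"
    moreover have "(\<lambda>v. if v < n then a v else e v)(n := b) =
        (\<lambda>v. if v < Suc n then (a(n := b)) v else e v)"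
      by auto
    ultimately show "\<exists>a. sat (\<lambda>v. if v < Suc n then a v else e v) \<phi>"
      by metis
  next
    fix a assume "sat (\<lambda>v. if v < Suc n then a v else e v) \<phi>"
    moreover have "(\<lambda>v. if v < Suc n then a v else e v) = (\<lambda>v. if v < n then a v else e v)(n := a n)"
      by auto
    ultimately show "\<exists>a b. sat ((\<lambda>v. if v < n then a v else e v)(n := b)) \<phi>"
      by metis
  qed
  then show ?case
    by (simp add: Suc)
qed simp

lemma fv_Exs [simp]: "fv (Exs n \<phi>) = fv \<phi> - {..<n}"
  by (induction n arbitrary: \<phi>) auto

primrec Conj :: "rform list \<Rightarrow> rform" where
  "Conj [] = Eq Zero Zero"
| "Conj (\<phi> # \<phi>s) = And \<phi> (Conj \<phi>s)"

lemma sat_Conj [simp]: "sat e (Conj \<phi>s) \<longleftrightarrow> (\<forall>\<phi>\<in>set \<phi>s. sat e \<phi>)"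
  by (induction \<phi>s) auto

lemma fv_Conj [simp]: "fv (Conj \<phi>s) = (\<Union>\<phi>\<in>set \<phi>s. fv \<phi>)"
  by (induction \<phi>s) auto

text \<open>With \<delta> expressing that two elements are inequivalent, this sentence says that
  there are at least \<open>n\<close> classes. It serves for infinitude of the field, infinitude of
  the quotient by \<open>range wp\<close>, and, with \<open>n = 2\<close>, failure of surjectivity
  of \<open>wp\<close>.\<close>

definition Pairwise :: "nat \<Rightarrow> (nat \<Rightarrow> nat \<Rightarrow> rform) \<Rightarrow> rform" where
  "Pairwise n \<delta> = Exs n (Conj [\<delta> i j. j \<leftarrow> [0..<n], i \<leftarrow> [0..<j]])"

lemma fv_Pairwise:
  "(\<And>i j. fv (\<delta> i j) \<subseteq> {i, j}) \<Longrightarrow> fv (Pairwise n \<delta>) = {}"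
  by (fastforce simp: Pairwise_def)

lemma sat_Pairwise:
  fixes R :: "'m::ring_1 \<Rightarrow> 'm \<Rightarrow> bool" and e :: "nat \<Rightarrow> 'm"
  assumes "\<And>i j e. sat e (\<delta> i j) \<longleftrightarrow> R (e i) (e j)"
  shows "sat e (Pairwise n \<delta>) \<longleftrightarrow> (\<exists>a. \<forall>j<n. \<forall>i<j. R (a i) (a j))"
  by (simp add: Pairwise_def sat_Exs assms atLeast0LessThan) (simp add: Ball_def)

text \<open>Infinitude is no single sentence, but splits into one bound for each \<open>n\<close>;
  each of these transfers between models.\<close>

lemma infinite_range_iff:
  "infinite (range (r :: 'a \<Rightarrow> 'b)) \<longleftrightarrow> (\<forall>n. \<exists>a :: nat \<Rightarrow> 'a. \<forall>j<n. \<forall>i<j. r (a i) \<noteq> r (a j))"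
proof safe
  fix n assume "infinite (range r)"
  then obtain f :: "nat \<Rightarrow> 'b" where f: "inj f" "range f \<subseteq> range r"
    using infinite_countable_subset by blast
  then have "\<forall>i. \<exists>x. r x = f i"
    by (metis rangeE range_subsetD)
  then obtain a where "\<And>i. r (a i) = f i"
    by metis
  then show "\<exists>a :: nat \<Rightarrow> 'a. \<forall>j<n. \<forall>i<j. r (a i) \<noteq> r (a j)"
    using f(1) by (intro exI[of _ a]) (auto dest: injD)
next
  assume "\<forall>n. \<exists>a :: nat \<Rightarrow> 'a. \<forall>j<n. \<forall>i<j. r (a i) \<noteq> r (a j)" and fin: "finite (range r)"
  then obtain a :: "nat \<Rightarrow> 'a" where a: "\<forall>j<Suc (card (range r)). \<forall>i<j. r (a i) \<noteq> r (a j)"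
    by blast
  then have "inj_on (r \<circ> a) {..<Suc (card (range r))}"
    by (intro linorder_inj_onI) auto
  then have "card {..<Suc (card (range r))} \<le> card (range r)"
    using fin by (intro card_inj_on_le) auto
  then show False
    by simp
qed

lemma models_Th_Pairwise_iff:
  fixes R :: "'k::ring_1 \<Rightarrow> 'k \<Rightarrow> bool" and R' :: "'m::ring_1 \<Rightarrow> 'm \<Rightarrow> bool"
  assumes "models TYPE('m) (Th TYPE('k))" "\<And>i j. fv (\<delta> i j) \<subseteq> {i, j}"
    and "\<And>i j e. sat e (\<delta> i j) \<longleftrightarrow> R (e i) (e j)" "\<And>i j e. sat e (\<delta> i j) \<longleftrightarrow> R' (e i) (e j)"
  shows "(\<exists>a :: nat \<Rightarrow> 'm. \<forall>j<n. \<forall>i<j. R' (a i) (a j)) \<longleftrightarrow>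
         (\<exists>a :: nat \<Rightarrow> 'k. \<forall>j<n. \<forall>i<j. R (a i) (a j))"
  using models_Th_holds_iff[OF assms(1) fv_Pairwise, of \<delta> n] assms(2)
  by (simp add: holds_def sat_Pairwise[where R = R, OF assms(3)] sat_Pairwise[where R = R', OF assms(4)])

lemma models_Th_infinite_iff:
  assumes "models TYPE('m::ring_1) (Th TYPE('k::ring_1))"
  shows "infinite (UNIV :: 'm set) \<longleftrightarrow> infinite (UNIV :: 'k set)"
  using models_Th_Pairwise_iff[OF assms, of "\<lambda>i j. Not (Eq (Var i) (Var j))" "(\<noteq>)" "(\<noteq>)"]
    infinite_range_iff[of "id :: 'm \<Rightarrow> 'm"] infinite_range_iff[of "id :: 'k \<Rightarrow> 'k"]
  by simp

primrec Num :: "nat \<Rightarrow> rterm" where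
  "Num 0 = Zero"
| "Num (Suc n) = Add One (Num n)"

lemma eval_Num [simp]: "eval_term e (Num n) = of_nat n"
  by (induction n) auto

lemma fv_Num [simp]: "fv_term (Num n) = {}"
  by (induction n) auto

lemma models_Th_CHAR:
  assumes "models TYPE('m::field) (Th TYPE('k::field))" and p: "prime CHAR('k)"
  shows "CHAR('m) = CHAR('k)"
proof -
  have "(of_nat CHAR('k) :: 'm) = 0"
    using models_Th_holds_iff[OF assms(1), of "Eq (Num CHAR('k)) Zero"] by (simp add: holds_def)
  then have "CHAR('m) dvd CHAR('k)"
    by (simp add: of_nat_eq_0_iff_char_dvd)
  then show ?thesis
    using p CHAR_not_1'[where 'a = 'm] by (auto simp: prime_nat_iff)
qed

lemma models_Th_incongruent_iff:
  assumes models: "models TYPE('m::field) (Th TYPE('k::field))" and p: "prime CHAR('k)"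
  shows "(\<exists>a :: nat \<Rightarrow> 'm. \<forall>j<n. \<forall>i<j. a i - a j \<notin> range wp) \<longleftrightarrow>
         (\<exists>a :: nat \<Rightarrow> 'k. \<forall>j<n. \<forall>i<j. a i - a j \<notin> range wp)"
proof (rule models_Th_Pairwise_iff[OF models])
  \<comment> \<open>The index \<open>Suc (i + j)\<close> exceeds both \<open>i\<close> and
    \<open>j\<close>, so the quantifier captures neither variable.\<close>
  let ?\<delta> = "\<lambda>i j. Not (Ex (Suc (i + j)) (Eq (Add (Var i) (Neg (Var j))) (AS_term CHAR('k) (Var (Suc (i + j))))))"
  show "fv (?\<delta> i j) \<subseteq> {i, j}" for i j
    using fv_AS_term[of "CHAR('k)" "Var (Suc (i + j))"] by auto
  show "sat e (?\<delta> i j) \<longleftrightarrow> e i - e j \<notin> range wp" for e :: "nat \<Rightarrow> 'k" and i j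
    by (auto simp: wp_def)
  show "sat e (?\<delta> i j) \<longleftrightarrow> e i - e j \<notin> range wp" for e :: "nat \<Rightarrow> 'm" and i j
    by (auto simp: wp_def models_Th_CHAR[OF models p])
qed

lemma models_Th_infinite_wp_rep_iff:
  assumes models: "models TYPE('m::field) (Th TYPE('k::field))" and p: "prime CHAR('k)"
  shows "infinite (range (wp_rep :: 'm \<Rightarrow> 'm)) \<longleftrightarrow> infinite (range (wp_rep :: 'k \<Rightarrow> 'k))"
  using models_Th_incongruent_iff[OF assms] models_Th_CHAR[OF assms] p
  by (simp add: infinite_range_iff wp_rep_eq_iff)

lemma range_wp_eq_UNIV_iff:
  assumes p: "prime CHAR('a::field)"
  shows "range wp \<noteq> (UNIV :: 'a set) \<longleftrightarrow> (\<exists>a :: nat \<Rightarrow> 'a. \<forall>j<2. \<forall>i<j. a i - a j \<notin> range wp)"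
proof
  assume "range wp \<noteq> (UNIV :: 'a set)"
  then obtain x :: 'a where "x \<notin> range wp"
    by auto
  then have "\<forall>j<(2::nat). \<forall>i<j. (if i = 0 then x else 0) - (if j = 0 then x else 0) \<notin> range wp"
    by (auto simp: less_2_cases_iff)
  then show "\<exists>a :: nat \<Rightarrow> 'a. \<forall>j<2. \<forall>i<j. a i - a j \<notin> range wp"
    by (intro exI[of _ "\<lambda>i. if i = 0 then x else 0"])
next
  assume "\<exists>a :: nat \<Rightarrow> 'a. \<forall>j<2. \<forall>i<j. a i - a j \<notin> range wp"
  then obtain a :: "nat \<Rightarrow> 'a" where "\<And>i j. j < 2 \<Longrightarrow> i < j \<Longrightarrow> a i - a j \<notin> range wp"
    by metis
  from this[of 1 0] have "a 0 - a 1 \<notin> range wp"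
    by simp
  then show "range wp \<noteq> (UNIV :: 'a set)"
    by (metis UNIV_I)
qed

lemma models_Th_range_wp_iff:
  assumes models: "models TYPE('m::field) (Th TYPE('k::field))" and p: "prime CHAR('k)"
  shows "range wp = (UNIV :: 'm set) \<longleftrightarrow> range wp = (UNIV :: 'k set)"
proof -
  have "prime CHAR('m)"
    using p by (simp add: models_Th_CHAR[OF assms])
  then show ?thesis
    using models_Th_incongruent_iff[OF assms, of 2] range_wp_eq_UNIV_iff[OF p]
      range_wp_eq_UNIV_iff[where 'a = 'm] by argo
qed

section \<open>Realising a generic element\<close>

primrec Horner :: "nat list \<Rightarrow> rterm" where
  "Horner [] = Zero"
| "Horner (c # cs) = Add (Num c) (Mul (Var 0) (Horner cs))"

lemma eval_Horner [simp]: "eval_term e (Horner cs) = poly (Poly (map of_nat cs)) (e 0 :: 'm::comm_ring_1)"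
  by (induction cs) auto

lemma fv_Horner: "fv_term (Horner cs) \<subseteq> {0}"
  by (induction cs) auto

lemma inj_power_char_power:
  assumes p: "prime CHAR('a::field)"
  shows "inj (\<lambda>x :: 'a. x ^ (CHAR('a) ^ N))"
proof (rule injI)
  fix x y :: 'a
  assume "x ^ (CHAR('a) ^ N) = y ^ (CHAR('a) ^ N)"
  then have "(x - y) ^ (CHAR('a) ^ N) = 0"
    using freshmans_dream'[OF p refl, of "x - y" y N] by simp
  then show "x = y"
    by simp
qed

text \<open>Finitely many conditions ask for a p^M-th power outside a finite set of roots. Iterated
  Frobenius is injective, so an infinite field has infinitely many p^M-th powers; a p^M-th power is
  also a p^N-th power for all N \<le> M.\<close>

lemma exists_generic:
  fixes \<kappa> :: "'c rel"
  assumes p: "prime CHAR('m::field)" and inf: "infinite (UNIV :: 'm set)"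
    and sat: "saturated \<kappa> TYPE('m)" and \<kappa>: "natLeq <o \<kappa>"
  shows "\<exists>\<theta> :: 'm. generic \<theta>"
proof -
  define f :: "nat list \<Rightarrow> 'm poly" where "f cs = Poly (map of_nat cs)" for cs
  define I :: "(nat + nat list) set" where "I = range Inl \<union> Inr ` {cs. f cs \<noteq> 0}"
  define \<phi> where "\<phi> = case_sum (\<lambda>N. Ex 1 (Eq (Pow (Var 1) (CHAR('m) ^ N)) (Var 0)))
    (\<lambda>cs. Not (Eq (Horner cs) Zero))"
  have "\<exists>\<theta> :: 'm. \<forall>i\<in>I. holds (\<phi> i) (\<theta> # [])"
  proof (rule saturated_countable[OF sat \<kappa>])
    show "fv (\<phi> i) \<subseteq> {..length []}" for i
      using fv_Horner fv_Pow[of "Var 1"] by (auto simp: \<phi>_def split: sum.split)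
  next
    fix J assume J: "finite J" "J \<subseteq> I"
    have "finite (Inl -` J)"
      using J(1) by (simp add: finite_vimageI)
    then obtain M where "\<forall>N\<in>Inl -` J. N \<le> M"
      using finite_nat_set_iff_bounded_le by blast
    then have M: "N \<le> M" if "Inl N \<in> J" for N
      using that by blast
    define bad where "bad = (\<Union>cs\<in>Inr -` J. {x. poly (f cs) x = 0})"
    have "finite bad"
      unfolding bad_def using J by (intro finite_UN_I finite_vimageI poly_roots_finite) (auto simp: I_def)
    moreover have "infinite (range (\<lambda>x :: 'm. x ^ (CHAR('m) ^ M)))"
      using inf finite_imageD[OF _ inj_power_char_power[OF p]] by blast
    ultimately obtain y where y: "y ^ (CHAR('m) ^ M) \<notin> bad"
      by (meson finite_subset image_subset_iff)
    have "holds (\<phi> i) [y ^ (CHAR('m) ^ M)]" if i: "i \<in> J" for i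
    proof (cases i)
      case (Inl N)
      then have "CHAR('m) ^ (M - N) * CHAR('m) ^ N = CHAR('m) ^ M"
        using M i by (simp flip: power_add)
      then have "(y ^ (CHAR('m) ^ (M - N))) ^ (CHAR('m) ^ N) = y ^ (CHAR('m) ^ M)"
        by (simp flip: power_mult)
      then show ?thesis
        unfolding Inl by (auto simp: \<phi>_def holds_def)
    next
      case (Inr cs)
      then show ?thesis
        using y i by (auto simp: \<phi>_def holds_def bad_def f_def)
    qed
    then have "\<forall>i\<in>J. holds (\<phi> i) [y ^ (CHAR('m) ^ M)]" ..
    then show "\<exists>b. \<forall>i\<in>J. holds (\<phi> i) [b :: 'm]" ..
  qed auto
  then obtain \<theta> :: 'm where \<theta>: "\<And>i. i \<in> I \<Longrightarrow> holds (\<phi> i) [\<theta>]"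
    by blast
  have "\<exists>y. y ^ (CHAR('m) ^ N) = \<theta>" for N
    using \<theta>[of "Inl N"] by (simp add: I_def \<phi>_def holds_def)
  moreover have "poly g \<theta> \<noteq> 0" if g: "g \<noteq> 0" "\<And>i. coeff g i \<in> range of_nat" for g
  proof -
    have "\<forall>c\<in>set (coeffs g). \<exists>n. c = of_nat n"
      using g(2) by (auto simp: coeffs_def)
    then obtain n where "\<And>c. c \<in> set (coeffs g) \<Longrightarrow> c = of_nat (n c)"
      by metis
    then have "map of_nat (map n (coeffs g)) = coeffs g"
      by (simp add: map_idI)
    then have "f (map n (coeffs g)) = g"
      unfolding f_def by (metis Poly_coeffs)
    with g \<theta>[of "Inr (map n (coeffs g))"] show ?thesis
      by (auto simp: I_def \<phi>_def holds_def f_def)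
  qed
  ultimately show ?thesis
    unfolding generic_def by blast
qed

section \<open>The first formula and the independence property\<close>

lemma not_has_IP_if_range_wp_UNIV:
  assumes n: "n \<ge> 1" and wp: "range wp = (UNIV :: 'm::field set)"
  shows "\<not> has_IP TYPE('m) n (AS_IP_form CHAR('m) n)"
proof
  assume "has_IP TYPE('m) n (AS_IP_form CHAR('m) n)"
  then obtain a :: "nat \<Rightarrow> nat \<Rightarrow> 'm" and b where
    ab: "\<And>J is. J \<subseteq> {is. length is = n} \<Longrightarrow> length is = n \<Longrightarrow>
      holds (AS_IP_form CHAR('m) n) (b J # map (\<lambda>k. a k (is ! k)) [0..<n]) \<longleftrightarrow> is \<in> J"
    unfolding has_IP_def by metis
  define c where "c is = (\<Prod>k<n. a k (is ! k))" for "is"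
  have "holds (AS_IP_form CHAR('m) n) (x # map (\<lambda>k. a k (is ! k)) [0..<n]) \<longleftrightarrow> c is \<noteq> 0 \<or> x = 0"
    for x :: 'm and "is"
  proof -
    have "(\<exists>t. x = c is * wp t) \<longleftrightarrow> (\<exists>s. x = c is * s)"
      using wp by (metis UNIV_I rangeE)
    also have "\<dots> \<longleftrightarrow> c is \<noteq> 0 \<or> x = 0"
      by (auto intro: exI[of _ "x / c is"])
    finally show ?thesis
      by (subst holds_AS_IP_form) (simp_all add: c_def)
  qed
  then have *: "c is \<noteq> 0 \<or> b J = 0 \<longleftrightarrow> is \<in> J" if "J \<subseteq> {is. length is = n}" "length is = n" for J "is"
    using ab[OF that] by simp
  \<comment> \<open>Two tuples, distinct because \<open>n \<ge> 1\<close>, suffice.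
    \<open>J = {}\<close> forces \<open>c i0 = 0\<close>; then \<open>J = {i0}\<close> forces
    \<open>b J = 0\<close>; but 0 satisfies the formula at every tuple, hence also at
    \<open>i1\<close>.\<close>
  define i0 i1 :: "nat list" where "i0 = replicate n 0" and "i1 = replicate n 1"
  have "i0 \<noteq> i1"
    using n by (cases n) (auto simp: i0_def i1_def)
  moreover have "length i0 = n" "length i1 = n"
    by (simp_all add: i0_def i1_def)
  ultimately show False
    using *[of "{}" i0] *[of "{i0}" i0] *[of "{i0}" i1] by auto
qed

lemma mult_inverse_in_range_wp_iff:
  fixes x c y :: "'a::field"
  assumes "c \<noteq> 0"
  shows "(\<exists>t. x = inverse c * wp t) \<longleftrightarrow> x * c \<in> range wp"
  using assms by (auto simp: field_simps image_iff)

lemma has_IP_if_range_wp_not_UNIV: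
  fixes \<kappa> :: "'c rel"
  assumes p: "prime CHAR('m::field)" and inf: "infinite (UNIV :: 'm set)"
    and sat: "saturated \<kappa> TYPE('m)" and \<kappa>: "natLeq <o \<kappa>" and wp: "range wp \<noteq> (UNIV :: 'm set)"
  shows "has_IP TYPE('m) n (AS_IP_form CHAR('m) n)"
proof -
  obtain \<theta> :: 'm where \<theta>: "generic \<theta>"
    using exists_generic[OF p inf sat \<kappa>] ..
  obtain e :: 'm where e: "e \<notin> range wp"
    using wp by auto
  \<comment> \<open>Along a tuple the parameters are multiplied, so their exponents add. Powers of
    two indexed by the pairs \<open>(k, i)\<close> make the sum the binary code of the graph of the
    tuple, so that different tuples give different exponents. The inverse turns the formula into a
    condition on \<open>b * \<theta> ^ s\<close>.\<close>
  define a where "a k i = inverse (\<theta> ^ (2 ^ prod_encode (k, i)))" for k i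
  define as where "as is = map (\<lambda>k. a k (is ! k)) [0..<n]" for "is"
  define graph where "graph is = (\<lambda>k. prod_encode (k, is ! k)) ` {..<n}" for "is"
  have prod: "(\<Prod>k<n. as is ! k) = inverse (\<theta> ^ set_encode (graph is))" for "is"
  proof -
    have "(\<Prod>k<n. as is ! k) = inverse (\<theta> ^ (\<Sum>k<n. 2 ^ prod_encode (k, is ! k)))"
      by (simp add: as_def a_def power_sum prod_inversef[symmetric])
    also have "(\<Sum>k<n. 2 ^ prod_encode (k, is ! k)) = set_encode (graph is)"
      unfolding set_encode_def graph_def by (subst sum.reindex) (auto simp: inj_on_def)
    finally show ?thesis .
  qed
  have inj: "inj_on (\<lambda>is. set_encode (graph is)) {is. length is = n}"
  proof (rule inj_onI)
    fix "is" js :: "nat list"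
    assume len: "is \<in> {is. length is = n}" "js \<in> {is. length is = n}"
      and "set_encode (graph is) = set_encode (graph js)"
    then have "graph is = graph js"
      by (simp add: set_encode_eq graph_def)
    have "is ! k = js ! k" if "k < n" for k
    proof -
      have "prod_encode (k, is ! k) \<in> graph is"
        using that by (simp add: graph_def)
      then have "prod_encode (k, is ! k) \<in> graph js"
        by (simp only: \<open>graph is = graph js\<close>)
      then show ?thesis
        by (auto simp: graph_def)
    qed
    then show "is = js"
      using len by (simp add: nth_equalityI)
  qed
  have holds: "holds (AS_IP_form CHAR('m) n) (x # as is) \<longleftrightarrow> x * \<theta> ^ set_encode (graph is) \<in> range wp"
    for x "is"
    using generic_nonzero[OF \<theta>] mult_inverse_in_range_wp_iff[of "\<theta> ^ set_encode (graph is)" x]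
    by (subst holds_AS_IP_form) (simp_all add: prod, simp add: as_def)
  have "\<exists>b. \<forall>is\<in>{is. length is = n}. holds (AS_IP_form CHAR('m) n) (b # as is) \<longleftrightarrow> is \<in> J" for J
  proof -
    define \<phi> where "\<phi> is = (if is \<in> J then AS_IP_form CHAR('m) n else Not (AS_IP_form CHAR('m) n))" for "is"
    have \<phi>: "holds (\<phi> is) xs \<longleftrightarrow> (holds (AS_IP_form CHAR('m) n) xs \<longleftrightarrow> is \<in> J)" for "is" and xs :: "'m list"
      by (simp add: \<phi>_def holds_def)
    have "\<exists>b. \<forall>is\<in>{is. length is = n}. holds (\<phi> is) (b # as is)"
    proof (rule saturated_countable[OF sat \<kappa>])
      show "fv (\<phi> is) \<subseteq> {..length (as is)}" for "is"
        using fv_AS_IP_form by (auto simp: \<phi>_def as_def)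
    next
      fix D :: "nat list set" assume D: "finite D" "D \<subseteq> {is. length is = n}"
      \<comment> \<open>Interpolation takes its targets per exponent; injectivity of the code is
        what makes this prescription agree with membership of the tuple in \<open>J\<close>.\<close>
      define h where "h s = (if s \<in> (\<lambda>is. set_encode (graph is)) ` (D \<inter> J) then 0 else e)" for s
      obtain b where b: "\<And>is. is \<in> D \<Longrightarrow>
          b * \<theta> ^ set_encode (graph is) - h (set_encode (graph is)) \<in> range wp"
        using wp_interpolation[OF p \<theta> finite_imageI[OF D(1)], of "\<lambda>is. set_encode (graph is)" h] by blast
      have "b * \<theta> ^ set_encode (graph is) \<in> range wp \<longleftrightarrow> is \<in> J" if "is \<in> D" for "is"
      proof (cases "is \<in> J")
        case True
        then show ?thesis
          using b[OF that] that by (auto simp: h_def)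
      next
        case False
        then have "h (set_encode (graph is)) = e"
          using D that inj by (auto simp: h_def dest!: inj_onD)
        with b[OF that] e False show ?thesis
          using range_wp_diff[OF p, of "b * \<theta> ^ set_encode (graph is)" "b * \<theta> ^ set_encode (graph is) - e"]
          by auto
      qed
      then show "\<exists>b. \<forall>is\<in>D. holds (\<phi> is) (b # as is)"
        by (auto simp: \<phi> holds)
    qed (auto intro: countable_finite)
    then show ?thesis
      by (simp add: \<phi>)
  qed
  then have "\<forall>J. \<exists>b. \<forall>is\<in>{is. length is = n}. holds (AS_IP_form CHAR('m) n) (b # as is) \<longleftrightarrow> is \<in> J" ..
  from choice[OF this] obtain b where
    b: "\<forall>J. \<forall>is\<in>{is. length is = n}. holds (AS_IP_form CHAR('m) n) (b J # as is) \<longleftrightarrow> is \<in> J" ..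
  show ?thesis
    unfolding has_IP_def by (intro exI[of _ a] exI[of _ b]) (use b in \<open>simp add: as_def\<close>)
qed

section \<open>The second formula and the tree property\<close>

lemma has_TP2_if_infinite_wp_rep:
  fixes \<kappa> :: "'c rel"
  assumes p: "prime CHAR('m::field)" and inf: "infinite (UNIV :: 'm set)"
    and sat: "saturated \<kappa> TYPE('m)" and \<kappa>: "natLeq <o \<kappa>" and wp: "infinite (range (wp_rep :: 'm \<Rightarrow> 'm))"
  shows "has_TP2 TYPE('m) 2 (AS_TP2_form CHAR('m))"
proof -
  obtain \<theta> :: 'm where \<theta>: "generic \<theta>"
    using exists_generic[OF p inf sat \<kappa>] ..
  \<comment> \<open>Distinct values of \<open>wp_rep\<close> are incongruent modulo
    \<open>range wp\<close>; this will make any two formulas of a row contradictory.\<close>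
  obtain e :: "nat \<Rightarrow> 'm" where e: "inj e" "range e \<subseteq> range wp_rep"
    using infinite_countable_subset[OF wp] by blast
  then have rep: "wp_rep (e j) = e j" for j
    using p by (metis rangeE range_subsetD wp_rep_wp_rep)
  \<comment> \<open>After multiplication by \<theta>^i the instance reads x \<theta>^i + e_j \<in>
    \<open>range wp\<close>. A row thus runs through distinct cosets of one group, and a path is an
    interpolation problem with targets -e_(f i).\<close>
  define a where "a i j = [inverse (\<theta> ^ i), e j * inverse (\<theta> ^ i)]" for i j
  have holds: "holds (AS_TP2_form CHAR('m)) (x # a i j) \<longleftrightarrow> x * \<theta> ^ i + e j \<in> range wp" for x i j
    using generic_nonzero[OF \<theta>] mult_inverse_in_range_wp_iff[of "\<theta> ^ i" "x + e j * inverse (\<theta> ^ i)"]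
    by (simp add: a_def holds_AS_TP2_form algebra_simps)
  have "\<not> (\<exists>x. \<forall>j\<in>S. holds (AS_TP2_form CHAR('m)) (x # a i j))" if "finite S" "card S = 2" for i S
  proof
    assume "\<exists>x. \<forall>j\<in>S. holds (AS_TP2_form CHAR('m)) (x # a i j)"
    then obtain x where x: "\<And>j. j \<in> S \<Longrightarrow> x * \<theta> ^ i + e j \<in> range wp"
      by (auto simp: holds)
    obtain j j' where j: "j \<in> S" "j' \<in> S" "j \<noteq> j'"
      using \<open>card S = 2\<close> by (auto simp: card_2_iff)
    have "e j - e j' \<in> range wp"
      using range_wp_diff[OF p x[OF j(1)] x[OF j(2)]] by simp
    then have "e j = e j'"
      using rep wp_rep_eq_iff[OF p] by metis
    with j e(1) show False
      by (auto dest: injD)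
  qed
  moreover have "\<exists>x. \<forall>i. holds (AS_TP2_form CHAR('m)) (x # a i (f i))" for f
  proof -
    have "\<exists>x. \<forall>i\<in>UNIV. holds (AS_TP2_form CHAR('m)) (x # a i (f i))"
    proof (rule saturated_countable[OF sat \<kappa>])
      show "fv (AS_TP2_form CHAR('m)) \<subseteq> {..length (a i (f i))}" for i
        using fv_AS_TP2_form[of "CHAR('m)"] by (simp add: a_def numeral_2_eq_2)
    next
      fix J :: "nat set" assume "finite J"
      from wp_interpolation[OF p \<theta> this, of "\<lambda>i. - e (f i)"]
      show "\<exists>x. \<forall>i\<in>J. holds (AS_TP2_form CHAR('m)) (x # a i (f i))"
        by (simp add: holds)
    qed (auto intro: countable_finite)
    then show ?thesis
      by simp
  qed
  moreover have "length (a i j) = 2" for i j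
    by (simp add: a_def)
  ultimately show ?thesis
    unfolding has_TP2_def by (intro exI[of _ a] exI[of _ 2]) blast
qed

lemma not_has_TP2_if_finite_wp_rep:
  assumes p: "prime CHAR('m::field)" and fin: "finite (range (wp_rep :: 'm \<Rightarrow> 'm))"
  shows "\<not> has_TP2 TYPE('m) 2 (AS_TP2_form CHAR('m))"
proof
  assume "has_TP2 TYPE('m) 2 (AS_TP2_form CHAR('m))"
  then obtain a :: "nat \<Rightarrow> nat \<Rightarrow> 'm list" and k where ak: "(\<forall>i j. length (a i j) = 2) \<and>
      (\<forall>i S. finite S \<and> card S = k \<longrightarrow> \<not> (\<exists>x. \<forall>j\<in>S. holds (AS_TP2_form CHAR('m)) (x # a i j))) \<and>
      (\<forall>f :: nat \<Rightarrow> nat. \<exists>x. \<forall>i. holds (AS_TP2_form CHAR('m)) (x # a i (f i)))"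
    unfolding has_TP2_def by (elim exE) (rule that)
  then have len: "length (a i j) = 2"
    and row: "finite S \<Longrightarrow> card S = k \<Longrightarrow> \<not> (\<forall>j\<in>S. holds (AS_TP2_form CHAR('m)) (x # a i j))"
    and path: "\<exists>x. \<forall>i. holds (AS_TP2_form CHAR('m)) (x # a i (f i))" for i j S x and f :: "nat \<Rightarrow> nat"
    by auto
  define y z where "y i j = a i j ! 0" and "z i j = a i j ! 1" for i j
  have "a i j = [y i j, z i j]" for i j
    using len[of i j] by (auto simp: y_def z_def numeral_2_eq_2 length_Suc_conv)
  then have holds: "holds (AS_TP2_form CHAR('m)) (x # a i j) \<longleftrightarrow> (\<exists>t. x + z i j = y i j * wp t)" for x i j
    by (simp add: holds_AS_TP2_form)
  have bound: "card {j \<in> J. \<exists>t. x + z i j = y i j * wp t} < k" if "finite J" for J i x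
  proof (rule ccontr)
    assume "\<not> ?thesis"
    then obtain S where "S \<subseteq> {j \<in> J. \<exists>t. x + z i j = y i j * wp t}" "card S = k" "finite S"
      by (meson not_le obtain_subset_with_card_n)
    with row[of S x i] show False
      by (auto simp: holds)
  qed
  have zero: "infinite {j. y i j = 0}" for i
  proof
    assume "finite {j. y i j = 0}"
    then have "infinite {j. y i j \<noteq> 0}"
      by (metis (mono_tags, lifting) Collect_cong Compl_eq finite_compl infinite_UNIV_nat mem_Collect_eq)
    \<comment> \<open>With q classes, \<open>q * k\<close> columns are just enough: averaging yields
      a point in at least \<open>k\<close> of the cosets, against the bound for a row.\<close>
    then obtain J where J: "finite J" "card J = card (range (wp_rep :: 'm \<Rightarrow> 'm)) * k" "J \<subseteq> {j. y i j \<noteq> 0}"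
      using infinite_arbitrarily_large by blast
    obtain x where x: "card J \<le> card (range (wp_rep :: 'm \<Rightarrow> 'm)) *
        card {j \<in> J. x / y i j - (- z i j / y i j) \<in> range wp}"
      using exists_point_in_many_cosets[OF p fin J(1), of "y i" "\<lambda>j. - z i j / y i j"] J(3) by blast
    have "x / y i j - (- z i j / y i j) \<in> range wp \<longleftrightarrow> (\<exists>t. x + z i j = y i j * wp t)" if "y i j \<noteq> 0" for j
      using mult_inverse_in_range_wp_iff[of "inverse (y i j)" "x + z i j"] that
      by (simp add: divide_inverse distrib_right)
    then have "{j \<in> J. x / y i j - (- z i j / y i j) \<in> range wp} = {j \<in> J. \<exists>t. x + z i j = y i j * wp t}"
      using J(3) by blast
    with x J(2) bound[OF J(1), of x i] fin show False
      by (simp add: card_gt_0_iff)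
  qed
  obtain j1 where j1: "y 1 j1 = 0"
    using zero[of 1] by (metis (mono_tags, lifting) Collect_empty_eq finite.emptyI)
  \<comment> \<open>A zero \<open>y\<close> leaves \<open>- z\<close> as the only solution. A path
    through column \<open>j\<close> of row 0 and column \<open>j1\<close> of row 1 makes two such
    solutions agree, so infinitely many formulas of row 0 hold at the one point
    \<open>- z 1 j1\<close>.\<close>
  have z: "z 0 j = z 1 j1" if "y 0 j = 0" for j
  proof -
    obtain x where "\<And>i. holds (AS_TP2_form CHAR('m)) (x # a i (if i = 0 then j else j1))"
      using path[of "\<lambda>i. if i = 0 then j else j1"] by blast
    from this[of 0] this[of 1] show ?thesis
      using that j1 by (simp add: holds) (metis add_left_cancel)
  qed
  obtain J where J: "finite J" "card J = k" "J \<subseteq> {j. y 0 j = 0}"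
    using infinite_arbitrarily_large[OF zero[of 0]] by blast
  then have "{j \<in> J. \<exists>t. - z 1 j1 + z 0 j = y 0 j * wp t} = J"
    using z by auto
  then show False
    using bound[OF J(1), of "- z 1 j1" 0] J(2) by simp
qed

section \<open>Simple extensions and degrees\<close>

abbreviation ev :: "'k::field poly \<Rightarrow> 'k alg_closure \<Rightarrow> 'k alg_closure" where
  "ev f x \<equiv> poly (map_poly to_ac f) x"

lemma map_poly_to_ac_add [simp]: "map_poly to_ac (f + g) = map_poly to_ac f + map_poly to_ac g"
  by (rule poly_eqI) (simp add: coeff_map_poly)

lemma map_poly_to_ac_diff [simp]: "map_poly to_ac (f - g) = map_poly to_ac f - map_poly to_ac g"
  by (rule poly_eqI) (simp add: coeff_map_poly)

lemma map_poly_to_ac_minus [simp]: "map_poly to_ac (- f) = - map_poly to_ac f"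
  by (rule poly_eqI) (simp add: coeff_map_poly)

lemma map_poly_to_ac_mult [simp]: "map_poly to_ac (f * g) = map_poly to_ac f * map_poly to_ac g"
  by (rule poly_eqI) (simp add: coeff_map_poly coeff_mult to_ac_sum)

lemma map_poly_to_ac_smult [simp]: "map_poly to_ac (smult c f) = smult (to_ac c) (map_poly to_ac f)"
  by (rule poly_eqI) (simp add: coeff_map_poly)

lemma map_poly_to_ac_pCons [simp]: "map_poly to_ac (pCons c f) = pCons (to_ac c) (map_poly to_ac f)"
  by (rule map_poly_pCons) simp

lemma map_poly_to_ac_monom [simp]: "map_poly to_ac (monom c n) = monom (to_ac c) n"
  by (rule map_poly_monom) simp

lemma map_poly_to_ac_power [simp]: "map_poly to_ac (f ^ n) = map_poly to_ac f ^ n"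
  by (induction n) simp_all

lemma map_poly_to_ac_sum [simp]: "map_poly to_ac (sum f I) = (\<Sum>i\<in>I. map_poly to_ac (f i))"
  by (induction I rule: infinite_finite_induct) simp_all

lemma map_poly_to_ac_eq_0_iff [simp]: "map_poly to_ac f = 0 \<longleftrightarrow> f = 0"
  by (rule map_poly_eq_0_iff) simp_all

lemma degree_map_poly_to_ac [simp]: "degree (map_poly to_ac f) = degree f"
  by (rule degree_map_poly) simp

lemma wp_to_ac: "wp (to_ac t) = to_ac (wp (t :: 'k::field))"
  by (simp add: wp_def)

interpretation ac: vector_space "\<lambda>(c :: 'k::field) x. to_ac c * x"
  by unfold_locales (simp_all add: algebra_simps)

text \<open>The ring K[x], which is already the field K(x) since every element of the closure is
  algebraic over K.\<close>

definition gen :: "'k::field alg_closure \<Rightarrow> 'k alg_closure set" where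
  "gen x = range (\<lambda>f. ev f x)"

lemma ev_in_gen [simp]: "ev f x \<in> gen x"
  by (simp add: gen_def)

lemma gen_cases: 
  assumes "y \<in> gen x"
  obtains f where "y = ev f x"
  using assms by (auto simp: gen_def)

lemma gen_self [simp]: "x \<in> gen x"
  using ev_in_gen[of "[:0, 1:]" x] by simp

lemma to_ac_in_gen [simp]: "to_ac c \<in> gen x"
  using ev_in_gen[of "[:c:]" x] by simp

lemma gen_add: "y \<in> gen x \<Longrightarrow> z \<in> gen x \<Longrightarrow> y + z \<in> gen x"
  by (elim gen_cases) (metis ev_in_gen map_poly_to_ac_add poly_add)

lemma gen_mult: "y \<in> gen x \<Longrightarrow> z \<in> gen x \<Longrightarrow> y * z \<in> gen x"
  by (elim gen_cases) (metis ev_in_gen map_poly_to_ac_mult poly_mult)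

lemma gen_subset:
  assumes "range to_ac \<subseteq> E" "\<And>y z. y \<in> E \<Longrightarrow> z \<in> E \<Longrightarrow> y + z \<in> E \<and> y * z \<in> E" "x \<in> E"
  shows "gen x \<subseteq> E"
proof
  fix y assume "y \<in> gen x"
  then obtain f where "y = ev f x"
    by (rule gen_cases)
  moreover have "ev f x \<in> E"
    using assms by (induction f) (auto simp: image_subset_iff, metis to_ac_0)
  ultimately show "y \<in> E"
    by simp
qed

text \<open>An algebraic relation for a nonzero \<open>y\<close> is divided by \<open>y\<close>
  until its constant term \<open>c\<close> is nonzero; it then reads
  \<open>y * ev h y = - to_ac c\<close> and exhibits the inverse.\<close>

lemma inverse_in_gen: "inverse y \<in> gen y"
proof (cases "y = 0")
  case False
  obtain g where "g \<noteq> 0" "ev g y = 0"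
    using alg_closure_algebraic by blast
  then show ?thesis
  proof (induction g)
    case (pCons c h)
    show ?case
    proof (cases "c = 0")
      case True
      then have "h \<noteq> 0" "ev h y = 0"
        using pCons.prems False by auto
      then show ?thesis
        by (rule pCons.IH)
    next
      case c: False
      have yh: "y * ev h y = - to_ac c"
        using pCons.prems by (simp add: eq_neg_iff_add_eq_0 add.commute)
      then have "ev h y \<noteq> 0"
        using c by auto
      then have "inverse y = inverse (y * ev h y) * ev h y"
        by simp
      also have "\<dots> = ev (smult (inverse (- c)) h) y"
        by (simp add: yh)
      finally have "inverse y = ev (smult (inverse (- c)) h) y" .
      then show ?thesis
        by (metis ev_in_gen)
    qed
  qed simp
qed (metis gen_self inverse_zero)

lemma intermediate_field_gen: "intermediate_field (gen (x :: 'k::field alg_closure))"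
  unfolding intermediate_field_def
proof (intro conjI ballI)
  show "range to_ac \<subseteq> gen x"
    by auto
  show "- y \<in> gen x" if "y \<in> gen x" for y
    using gen_mult[OF that to_ac_in_gen[of "- 1"]] by simp
  show "inverse y \<in> gen x" if "y \<in> gen x" for y
  proof -
    have "gen y \<subseteq> gen x"
      using that by (intro gen_subset) (auto simp: gen_add gen_mult)
    then show ?thesis
      using inverse_in_gen by blast
  qed
qed (auto simp: gen_add gen_mult)

lemma gen_subset_intermediate_field: "intermediate_field E \<Longrightarrow> x \<in> E \<Longrightarrow> gen x \<subseteq> E"
  by (rule gen_subset) (auto simp: intermediate_field_def)

lemma intermediate_field_power: "intermediate_field E \<Longrightarrow> x \<in> E \<Longrightarrow> x ^ n \<in> E"
  by (induction n) (auto simp: intermediate_field_def image_subset_iff, metis to_ac_1)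

lemma subspace_intermediate_field: "intermediate_field E \<Longrightarrow> ac.subspace E"
  by (auto simp: intermediate_field_def ac.subspace_def image_subset_iff, metis to_ac_0)

section \<open>Minimal polynomials\<close>

definition min_poly :: "'k::field alg_closure \<Rightarrow> 'k poly" where
  "min_poly x = (SOME g. lead_coeff g = 1 \<and> ev g x = 0 \<and>
     (\<forall>f. f \<noteq> 0 \<longrightarrow> ev f x = 0 \<longrightarrow> degree g \<le> degree f))"

lemma min_poly:
  shows lead_coeff_min_poly: "lead_coeff (min_poly x) = 1"
    and ev_min_poly [simp]: "ev (min_poly x) x = 0"
    and degree_min_poly_le: "f \<noteq> 0 \<Longrightarrow> ev f x = 0 \<Longrightarrow> degree (min_poly x) \<le> degree f"
proof -
  let ?P = "\<lambda>g. lead_coeff g = 1 \<and> ev g x = 0 \<and> (\<forall>f. f \<noteq> 0 \<longrightarrow> ev f x = 0 \<longrightarrow> degree g \<le> degree f)"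
  obtain g0 where "g0 \<noteq> 0 \<and> ev g0 x = 0"
    using alg_closure_algebraic[of x] by blast
  then obtain g where g: "g \<noteq> 0 \<and> ev g x = 0" "\<And>f. f \<noteq> 0 \<and> ev f x = 0 \<Longrightarrow> degree g \<le> degree f"
    using ex_has_least_nat[of "\<lambda>g. g \<noteq> 0 \<and> ev g x = 0" g0 degree] by blast
  have "?P (smult (inverse (lead_coeff g)) g)"
    using g by simp
  then have "?P (min_poly x)"
    unfolding min_poly_def by (rule someI)
  then show "lead_coeff (min_poly x) = 1" "ev (min_poly x) x = 0"
    "f \<noteq> 0 \<Longrightarrow> ev f x = 0 \<Longrightarrow> degree (min_poly x) \<le> degree f"
    by blast+
qed

lemma min_poly_nonzero [simp]: "min_poly x \<noteq> 0"
  using lead_coeff_min_poly[of x] by auto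

lemma degree_min_poly_pos [simp]: "degree (min_poly x) > 0"
proof (rule ccontr)
  assume "\<not> ?thesis"
  then have "min_poly x = [:1:]"
    using lead_coeff_min_poly[of x] by (metis degree_0_id neq0_conv gr_zeroI degree_eq_zeroE coeff_pCons_0)
  then show False
    using ev_min_poly[of x] by simp
qed

lemma ev_eq_0_iff: "ev f x = 0 \<longleftrightarrow> min_poly x dvd f"
proof
  assume "ev f x = 0"
  then have "ev (f mod min_poly x) x = 0"
    by (simp flip: minus_div_mult_eq_mod)
  then have "f mod min_poly x = 0"
    using degree_min_poly_le[of "f mod min_poly x" x] degree_mod_less[of "min_poly x" f] by force
  then show "min_poly x dvd f"
    by auto
qed auto

lemma irreducible_min_poly: "irreducible (min_poly x)"
proof (rule irreducibleI)
  show "\<not> is_unit (min_poly x)"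
    using degree_min_poly_pos[of x] by (simp add: is_unit_iff_degree)
  have unit: "is_unit b" if "min_poly x = a * b" "ev a x = 0" for a b
  proof -
    have "a \<noteq> 0" "b \<noteq> 0"
      using that(1) min_poly_nonzero[of x] by auto
    with that(1) have "degree (min_poly x) = degree a + degree b"
      by (simp add: degree_mult_eq)
    then show ?thesis
      using degree_min_poly_le[OF \<open>a \<noteq> 0\<close> that(2)] \<open>b \<noteq> 0\<close> by (simp add: is_unit_iff_degree)
  qed
  fix a b assume "min_poly x = a * b"
  then show "is_unit a \<or> is_unit b"
    using unit[of a b] unit[of b a] ev_min_poly[of x] by (auto simp: mult.commute)
qed simp

lemma finite_roots_min_poly: "finite {z. ev (min_poly y) z = 0}"
  by (rule poly_roots_finite) simp

lemma card_roots_min_poly: "card {z. ev (min_poly y) z = 0} \<le> degree (min_poly y)"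
  using card_poly_roots_bound[of "map_poly to_ac (min_poly y)"] by simp

text \<open>An irreducible polynomial with root \<open>x\<close> is an associate of
  \<open>min_poly x\<close>. This links minimal polynomials with the definitions of separability and
  normality, which speak of arbitrary irreducible polynomials.\<close>

lemma irreducible_dvd_iff_ev:
  assumes "irreducible f" "ev f x = 0"
  shows "f dvd g \<longleftrightarrow> ev g x = 0"
proof -
  have "min_poly x dvd f"
    using assms(2) by (simp add: ev_eq_0_iff)
  moreover have "\<not> is_unit (min_poly x)"
    using irreducible_min_poly irreducible_not_unit by blast
  ultimately have "f dvd min_poly x"
    using assms(1) irreducibleD' by blast
  then show ?thesis
    using \<open>min_poly x dvd f\<close> unfolding ev_eq_0_iff by (meson dvd_trans)
qed

lemma degree_min_poly_eq_1: "degree (min_poly x) = 1 \<Longrightarrow> x \<in> range to_ac"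
proof -
  assume deg: "degree (min_poly x) = 1"
  have "min_poly x = [:coeff (min_poly x) 0, coeff (min_poly x) 1:]"
    by (rule poly_eqI) (auto simp: coeff_pCons deg coeff_eq_0 split: nat.split)
  also have "coeff (min_poly x) 1 = 1"
    using lead_coeff_min_poly[of x] by (simp add: deg)
  finally have "ev [:coeff (min_poly x) 0, 1:] x = 0"
    using ev_min_poly[of x] by simp
  then have "x = to_ac (- coeff (min_poly x) 0)"
    by (simp add: eq_neg_iff_add_eq_0 add.commute)
  then show ?thesis
    by blast
qed

definition stable_under :: "'k::field alg_closure \<Rightarrow> 'k alg_closure set \<Rightarrow> bool" where
  "stable_under \<gamma> V \<longleftrightarrow> (\<forall>v\<in>V. \<gamma> * v \<in> V)"

text \<open>A stable subspace is a vector space over the field \<open>gen \<gamma>\<close>. Through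
  it the tower argument can be run with linear algebra over K alone.\<close>

lemma stable_under_gen:
  assumes "stable_under \<gamma> V" "ac.subspace V" "v \<in> V" "y \<in> gen \<gamma>"
  shows "y * v \<in> V"
proof -
  obtain f where y: "y = ev f \<gamma>"
    using assms(4) by (rule gen_cases)
  have "ev f \<gamma> * v \<in> V" if "v \<in> V" for f v
    using that
  proof (induction f arbitrary: v)
    case 0
    then show ?case
      using assms(2) by (simp add: ac.subspace_0)
  next
    case (pCons c f)
    have "to_ac c * v + ev f \<gamma> * (\<gamma> * v) \<in> V"
      using pCons assms(1,2) by (intro ac.subspace_add ac.subspace_scale) (auto simp: stable_under_def)
    then show ?case
      by (simp add: algebra_simps)
  qed
  then show ?thesis
    using assms(3) y by blast
qed

lemma stable_under_span:
  assumes "\<And>b. b \<in> B \<Longrightarrow> \<gamma> * b \<in> ac.span B"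
  shows "stable_under \<gamma> (ac.span B)"
  unfolding stable_under_def
proof
  fix v assume "v \<in> ac.span B"
  then show "\<gamma> * v \<in> ac.span B"
  proof (induction rule: ac.span_induct_alt)
    case (step c x y)
    have "to_ac c * (\<gamma> * x) + \<gamma> * y \<in> ac.span B"
      using step assms by (intro ac.span_add ac.span_scale) auto
    then show ?case
      by (simp add: algebra_simps)
  qed (simp add: ac.span_zero)
qed

text \<open>Adds one more copy of \<open>gen \<gamma>\<close> to a direct sum of copies, as in the proof of the tower law.\<close>
lemma extend_stable_span:
  assumes B: "finite B" "ac.independent B" "stable_under \<gamma> (ac.span B)" and x: "x \<notin> ac.span B"
    and d: "d = degree (min_poly \<gamma>)"
    and B': "B' = B \<union> (\<lambda>j. x * \<gamma> ^ j) ` {..<d}"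
  shows "ac.independent B'" "card B' = card B + d" "stable_under \<gamma> (ac.span B')"
proof -
  define C where "C j = B \<union> (\<lambda>j. x * \<gamma> ^ j) ` {..<j}" for j
  \<comment> \<open>Modulo \<open>span B\<close>, elements of \<open>span (C j)\<close> are handled
    as polynomials in \<gamma> times \<open>x\<close>. The alternative \<open>h = 0\<close> is for
    \<open>j = 0\<close>, where no degree is below the bound.\<close>
  have C: "\<exists>h. (degree h < j \<or> h = 0) \<and> v - ev h \<gamma> * x \<in> ac.span B"
    if "v \<in> ac.span (C j)" for v j
    using that
  proof (induction j arbitrary: v)
    case (Suc j)
    have "C (Suc j) = insert (x * \<gamma> ^ j) (C j)"
      by (auto simp: C_def lessThan_Suc)
    then obtain k where "v - to_ac k * (x * \<gamma> ^ j) \<in> ac.span (C j)"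
      using Suc.prems by (auto simp: ac.span_breakdown_eq)
    from Suc.IH[OF this] obtain h where h: "degree h < j \<or> h = 0"
      "v - to_ac k * (x * \<gamma> ^ j) - ev h \<gamma> * x \<in> ac.span B"
      by blast
    have "v - ev (h + monom k j) \<gamma> * x \<in> ac.span B"
      using h(2) by (simp add: poly_monom algebra_simps)
    moreover have "degree (h + monom k j) < Suc j"
      using h(1) by (auto simp: less_Suc_eq_le degree_monom_le intro!: degree_add_le)
    ultimately show ?case
      by blast
  qed (auto simp: C_def intro: exI[of _ 0])
  have notin: "x * \<gamma> ^ j \<notin> ac.span (C j)" if j: "j < d" for j
  proof
    assume "x * \<gamma> ^ j \<in> ac.span (C j)"
    from C[OF this] obtain h where h: "degree h < j \<or> h = 0" "x * \<gamma> ^ j - ev h \<gamma> * x \<in> ac.span B"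
      by blast
    \<comment> \<open>\<open>g\<close> is monic of degree \<open>j < d\<close>, so its value at
      \<gamma> is invertible in \<open>gen \<gamma>\<close>; stability of \<open>span B\<close>
      permits division by it, which would put \<open>x\<close> into \<open>span B\<close>.\<close>
    define g where "g = monom 1 j - h"
    have "coeff g j = 1"
      using h(1) by (auto simp: g_def coeff_eq_0)
    then have g0: "g \<noteq> 0"
      by auto
    have "degree g \<le> j"
      unfolding g_def using h(1) by (intro degree_diff_le) (auto simp: degree_monom_le)
    then have "ev g \<gamma> \<noteq> 0"
      using degree_min_poly_le[OF g0, of \<gamma>] j d by auto
    moreover have "ev g \<gamma> * x \<in> ac.span B"
      using h(2) by (simp add: g_def poly_monom algebra_simps)
    moreover have "inverse (ev g \<gamma>) \<in> gen \<gamma>"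
      using intermediate_field_gen[of \<gamma>] by (auto simp: intermediate_field_def)
    ultimately have "ev g \<gamma> \<noteq> 0" "inverse (ev g \<gamma>) * (ev g \<gamma> * x) \<in> ac.span B"
      using stable_under_gen[OF B(3) ac.subspace_span] by blast+
    then show False
      using x by (simp flip: mult.assoc)
  qed
  have "ac.independent (C j) \<and> card (C j) = card B + j \<and> finite (C j)" if "j \<le> d" for j
    using that
  proof (induction j)
    case (Suc j)
    have "C (Suc j) = insert (x * \<gamma> ^ j) (C j)"
      by (auto simp: C_def lessThan_Suc)
    moreover have "x * \<gamma> ^ j \<notin> C j"
      using notin[of j] Suc.prems ac.span_base by auto
    ultimately show ?case
      using Suc notin[of j] by (simp add: ac.independent_insert)
  qed (use B in \<open>simp add: C_def\<close>)
  moreover have B'C: "B' = C d"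
    by (simp add: B' C_def)
  ultimately show "ac.independent B'" "card B' = card B + d"
    by auto
  show "stable_under \<gamma> (ac.span B')"
  proof (rule stable_under_span)
    fix b assume "b \<in> B'"
    then consider "b \<in> B" | j where "j < d" "b = x * \<gamma> ^ j"
      by (auto simp: B')
    then show "\<gamma> * b \<in> ac.span B'"
    proof cases
      case 1
      then have "\<gamma> * b \<in> ac.span B"
        using B(3) by (auto simp: stable_under_def ac.span_base)
      then show ?thesis
        using ac.span_mono[of B B'] by (auto simp: B')
    next
      case 2
      show ?thesis
      proof (cases "Suc j < d")
        case True
        then have "x * \<gamma> ^ Suc j \<in> B'"
          unfolding B' by blast
        moreover have "\<gamma> * b = x * \<gamma> ^ Suc j"
          by (simp add: 2 mult_ac)
        ultimately show ?thesis
          by (simp only: ac.span_base)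
      next
        case False
        then have j: "Suc j = d"
          using 2 by simp
        \<comment> \<open>Multiplying the last new vector by \<gamma> overshoots to \<gamma>^d,
          which the monic minimal polynomial expresses through lower powers.\<close>
        have "(\<Sum>i\<le>d. to_ac (coeff (min_poly \<gamma>) i) * \<gamma> ^ i) = 0"
          using ev_min_poly[of \<gamma>] by (simp add: poly_altdef coeff_map_poly d)
        then have "\<gamma> ^ d = - (\<Sum>i<d. to_ac (coeff (min_poly \<gamma>) i) * \<gamma> ^ i)"
          using lead_coeff_min_poly[of \<gamma>]
          by (simp add: d eq_neg_iff_add_eq_0 add.commute flip: lessThan_Suc_atMost)
        moreover have "\<gamma> * b = x * \<gamma> ^ d"
          by (simp add: 2 mult_ac flip: j)
        ultimately have "\<gamma> * b = - (\<Sum>i<d. to_ac (coeff (min_poly \<gamma>) i) * (x * \<gamma> ^ i))"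
          by (simp add: mult_ac sum_distrib_left)
        also have "\<dots> \<in> ac.span B'"
          unfolding B' by (intro ac.span_neg ac.span_sum ac.span_scale ac.span_base) auto
        finally show ?thesis .
      qed
    qed
  qed
qed

text \<open>An independent subset of \<open>E\<close> with \<gamma>-stable span grows by
  \<open>d\<close> vectors at a time. Its size is bounded by the dimension, so it ends as a basis
  whose size is a multiple of \<open>d\<close>. A positive \<open>extension_degree\<close> means a
  finite extension.\<close>

lemma degree_min_poly_dvd_extension_degree:
  assumes E: "intermediate_field E" and pos: "extension_degree E > 0" and \<gamma>: "\<gamma> \<in> E"
  shows "degree (min_poly \<gamma>) dvd extension_degree E"
proof -
  define d where "d = degree (min_poly \<gamma>)"
  obtain T where T: "T \<subseteq> E" "ac.independent T" "E \<subseteq> ac.span T" "card T = extension_degree E"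
    unfolding extension_degree_def using ac.basis_exists by blast
  then have "finite T"
    using pos card_ge_0_finite by metis
  have bound: "card B \<le> extension_degree E" if "B \<subseteq> E" "ac.independent B" for B
    using ac.independent_span_bound[OF \<open>finite T\<close> that(2)] that(1) T(3,4) by auto
  have "d dvd extension_degree E"
    if "finite B" "B \<subseteq> E" "ac.independent B" "stable_under \<gamma> (ac.span B)" "d dvd card B" for B
    using that
  proof (induction "extension_degree E - card B" arbitrary: B rule: less_induct)
    case less
    show ?case
    proof (cases "E \<subseteq> ac.span B")
      case True
      then show ?thesis
        using ac.basis_card_eq_dim[OF less.prems(2) True less.prems(3)] less.prems(5)
        by (simp add: extension_degree_def)
    next
      case False
      then obtain x where x: "x \<in> E" "x \<notin> ac.span B"
        by blast
      define B' where "B' = B \<union> (\<lambda>j. x * \<gamma> ^ j) ` {..<d}"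
      note B' = extend_stable_span[OF less.prems(1,3,4) x(2) d_def B'_def]
      have "B' \<subseteq> E"
        using less.prems(2) x(1) \<gamma> intermediate_field_power[OF E \<gamma>] E
        by (auto simp: B'_def intermediate_field_def)
      moreover have "extension_degree E - card B' < extension_degree E - card B"
        using bound[OF \<open>B' \<subseteq> E\<close> B'(1)] B'(2) degree_min_poly_pos[of \<gamma>]
          unfolding d_def by linarith
      ultimately show ?thesis
        using B' less.prems by (intro less.hyps[of B']) (auto simp: B'_def)
    qed
  qed
  from this[of "{}"] show ?thesis
    by (simp add: d_def stable_under_def ac.independent_empty)
qed

lemma gen_basis:
  defines "P x \<equiv> (\<lambda>j. x ^ j) ` {..<degree (min_poly x)}"
  shows "ac.independent (P x)" "card (P x) = degree (min_poly x)" "ac.span (P x) = gen x"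
proof -
  \<comment> \<open>The powers of \<open>x\<close> arise by enlarging the empty set once, with the
    vector 1.\<close>
  have P: "P x = {} \<union> (\<lambda>j. 1 * x ^ j) ` {..<degree (min_poly x)}"
    by (simp add: P_def)
  have "stable_under x (ac.span {})"
    by (simp add: stable_under_def)
  note * = extend_stable_span[OF _ _ this _ refl P]
  show "ac.independent (P x)" "card (P x) = degree (min_poly x)"
    using * by (auto simp: ac.independent_empty)
  have stable: "stable_under x (ac.span (P x))"
    using * by (auto simp: ac.independent_empty)
  have "1 \<in> P x"
    by (auto simp: P_def intro: image_eqI[of _ _ 0])
  then have "gen x \<subseteq> ac.span (P x)"
    using stable_under_gen[OF stable _ ac.span_base, of 1] by auto
  moreover have "ac.span (P x) \<subseteq> gen x"
    using subspace_intermediate_field[OF intermediate_field_gen]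
      intermediate_field_power[OF intermediate_field_gen gen_self]
    by (intro ac.span_minimal) (auto simp: P_def)
  ultimately show "ac.span (P x) = gen x"
    by blast
qed

lemma extension_degree_gen: "extension_degree (gen x) = degree (min_poly x)"
  unfolding extension_degree_def
  using gen_basis[of x] ac.dim_span_eq_card_independent by metis

text \<open>The degree of an element divides the prime, and it is not 1 outside the base field. The
  lemma stands in for the absence of intermediate fields in prime degree.\<close>

lemma prime_degree_gen:
  assumes E: "intermediate_field E" and p: "prime (extension_degree E)"
    and x: "x \<in> E" "x \<notin> range to_ac"
  shows "degree (min_poly x) = extension_degree E" "gen x = E"
proof -
  have pos: "extension_degree E > 0"
    using p prime_gt_0_nat by blast
  then show deg: "degree (min_poly x) = extension_degree E"
    using degree_min_poly_dvd_extension_degree[OF E pos x(1)] p degree_min_poly_eq_1[of x] x(2)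
    by (auto simp: prime_nat_iff)
  obtain T where T: "T \<subseteq> E" "ac.independent T" "E \<subseteq> ac.span T" "card T = extension_degree E"
    unfolding extension_degree_def using ac.basis_exists by blast
  then have "finite T"
    using pos card_ge_0_finite by metis
  define P where "P = (\<lambda>j. x ^ j) ` {..<degree (min_poly x)}"
  note P = gen_basis[of x, folded P_def]
  have sub: "gen x \<subseteq> E"
    by (rule gen_subset_intermediate_field[OF E x(1)])
  have "y \<in> gen x" if "y \<in> E" for y
  proof (rule ccontr)
    assume y: "y \<notin> gen x"
    then have "ac.independent (insert y P)"
      using P by (intro ac.independent_insertI) auto
    moreover have "insert y P \<subseteq> ac.span T"
      using sub that T(3) P(3) ac.span_superset[of P] by auto
    ultimately have "card (insert y P) \<le> card T"
      using ac.independent_span_bound[OF \<open>finite T\<close>] by blast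
    moreover have "y \<notin> P"
      using y P(3) ac.span_base by blast
    ultimately show False
      using P(2) T(4) deg by (simp add: P_def)
  qed
  with sub show "gen x = E"
    by blast
qed

section \<open>Endomorphisms over the base field\<close>

text \<open>\<sigma> is a total function on the algebraic closure with arbitrary values outside
  \<open>E\<close>, so every law carries membership in \<open>E\<close>. Injectivity follows from
  the field structure, and surjectivity on an orbit from its finiteness.\<close>

locale K_endomorphism =
  fixes E :: "'k::field alg_closure set" and \<sigma> :: "'k alg_closure \<Rightarrow> 'k alg_closure"
  assumes E: "intermediate_field E"
    and closed: "y \<in> E \<Longrightarrow> \<sigma> y \<in> E"
    and fixes_base [simp]: "\<sigma> (to_ac c) = to_ac c"
    and add: "y \<in> E \<Longrightarrow> z \<in> E \<Longrightarrow> \<sigma> (y + z) = \<sigma> y + \<sigma> z"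
    and mult: "y \<in> E \<Longrightarrow> z \<in> E \<Longrightarrow> \<sigma> (y * z) = \<sigma> y * \<sigma> z"
begin

lemma field_closed:
  shows base_in_E [simp]: "to_ac c \<in> E"
    and add_in_E: "y \<in> E \<Longrightarrow> z \<in> E \<Longrightarrow> y + z \<in> E"
    and mult_in_E: "y \<in> E \<Longrightarrow> z \<in> E \<Longrightarrow> y * z \<in> E"
    and minus_in_E: "y \<in> E \<Longrightarrow> - y \<in> E"
    and inverse_in_E: "y \<in> E \<Longrightarrow> inverse y \<in> E"
  using E by (auto simp: intermediate_field_def)

lemma zero_in_E [simp]: "0 \<in> E" and one_in_E [simp]: "1 \<in> E"
  using base_in_E[of 0] base_in_E[of 1] by simp_all

lemma diff_in_E: "y \<in> E \<Longrightarrow> z \<in> E \<Longrightarrow> y - z \<in> E"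
  using add_in_E[of y "- z"] minus_in_E[of z] by simp

lemma zero [simp]: "\<sigma> 0 = 0" and one [simp]: "\<sigma> 1 = 1"
  using fixes_base[of 0] fixes_base[of 1] by simp_all

lemma diff: "y \<in> E \<Longrightarrow> z \<in> E \<Longrightarrow> \<sigma> (y - z) = \<sigma> y - \<sigma> z"
  using add[of "y - z" z] diff_in_E[of y z] by simp

lemma minus: "y \<in> E \<Longrightarrow> \<sigma> (- y) = - \<sigma> y"
  using diff[of 0 y] by simp

lemma power: "y \<in> E \<Longrightarrow> \<sigma> (y ^ n) = \<sigma> y ^ n"
  by (induction n) (auto simp: mult intermediate_field_power[OF E])

lemma wp: "y \<in> E \<Longrightarrow> \<sigma> (wp y) = wp (\<sigma> y)"
  by (simp add: wp_def diff power intermediate_field_power[OF E])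

lemma ev_in_E: "y \<in> E \<Longrightarrow> ev f y \<in> E"
  by (induction f) (auto simp: add_in_E mult_in_E)

lemma ev: "y \<in> E \<Longrightarrow> \<sigma> (ev f y) = ev f (\<sigma> y)"
  by (induction f) (auto simp: add mult mult_in_E ev_in_E)

lemma inj: "inj_on \<sigma> E"
proof (rule inj_onI)
  fix y z assume yz: "y \<in> E" "z \<in> E" "\<sigma> y = \<sigma> z"
  show "y = z"
  proof (rule ccontr)
    assume "y \<noteq> z"
    then have "\<sigma> ((y - z) * inverse (y - z)) = 1"
      by simp
    moreover have "\<sigma> ((y - z) * inverse (y - z)) = 0"
      using yz by (simp add: mult diff diff_in_E inverse_in_E)
    ultimately show False
      by simp
  qed
qed

lemma funpow_in_E: "y \<in> E \<Longrightarrow> (\<sigma> ^^ i) y \<in> E"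
  by (induction i) (auto simp: closed)

lemma funpow_ev: "y \<in> E \<Longrightarrow> (\<sigma> ^^ i) (ev f y) = ev f ((\<sigma> ^^ i) y)"
  by (induction i) (auto simp: ev funpow_in_E)

definition orbit :: "'k alg_closure \<Rightarrow> 'k alg_closure set" where
  "orbit y = range (\<lambda>i. (\<sigma> ^^ i) y)"

lemma orbit_subset_E: "y \<in> E \<Longrightarrow> orbit y \<subseteq> E"
  by (auto simp: orbit_def funpow_in_E)

lemma self_in_orbit: "y \<in> orbit y"
  by (auto simp: orbit_def intro: range_eqI[of _ _ 0])

lemma funpow_zero [simp]: "(\<sigma> ^^ i) 0 = 0"
  by (induction i) auto

lemma orbit_subset_roots:
  assumes "y \<in> E"
  shows "orbit y \<subseteq> {z. ev (min_poly y) z = 0}"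
proof -
  have "ev (min_poly y) ((\<sigma> ^^ i) y) = 0" for i
    using funpow_ev[OF assms, of i "min_poly y"] by simp
  then show ?thesis
    by (auto simp: orbit_def)
qed

lemma finite_orbit: "y \<in> E \<Longrightarrow> finite (orbit y)"
  using orbit_subset_roots finite_roots_min_poly finite_subset by blast

lemma image_orbit:
  assumes "y \<in> E"
  shows "\<sigma> ` orbit y = orbit y"
proof (rule card_subset_eq)
  show "finite (orbit y)"
    by (rule finite_orbit[OF assms])
  show "\<sigma> ` orbit y \<subseteq> orbit y"
    by (auto simp: orbit_def simp flip: funpow.simps(2) comp_apply[of \<sigma>])
  show "card (\<sigma> ` orbit y) = card (orbit y)"
    by (intro card_image inj_on_subset[OF inj] orbit_subset_E assms)
qed

text \<open>\<sigma> respects sums and products only within \<open>E\<close>, so the location of the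
  coefficients has to be proved along with the identity.\<close>

lemma map_poly_linear_mult:
  assumes "\<And>i. coeff P i \<in> E" "s \<in> E"
  shows "map_poly \<sigma> ([:- s, 1:] * P) = [:- \<sigma> s, 1:] * map_poly \<sigma> P"
    and "coeff ([:- s, 1:] * P) i \<in> E"
proof -
  have *: "coeff ([:- s, 1:] * P) i = (case i of 0 \<Rightarrow> 0 | Suc j \<Rightarrow> coeff P j) - s * coeff P i"
    for s :: "'k alg_closure" and P and i
    by (simp add: coeff_pCons split: nat.split)
  show "coeff ([:- s, 1:] * P) i \<in> E"
    unfolding * using assms by (auto split: nat.split intro!: diff_in_E minus_in_E mult_in_E)
  show "map_poly \<sigma> ([:- s, 1:] * P) = [:- \<sigma> s, 1:] * map_poly \<sigma> P"
    by (rule poly_eqI, subst *, subst coeff_map_poly, simp, subst *)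
       (use assms in \<open>auto split: nat.split simp: coeff_map_poly diff mult mult_in_E minus minus_in_E\<close>)
qed

lemma map_poly_prod_linear:
  assumes "finite O'" "O' \<subseteq> E"
  shows "map_poly \<sigma> (\<Prod>s\<in>O'. [:- s, 1:]) = (\<Prod>s\<in>O'. [:- \<sigma> s, 1:])"
    and "coeff (\<Prod>s\<in>O'. [:- s, 1:]) i \<in> E"
proof -
  have "map_poly \<sigma> (\<Prod>s\<in>O'. [:- s, 1:]) = (\<Prod>s\<in>O'. [:- \<sigma> s, 1:]) \<and>
      (\<forall>i. coeff (\<Prod>s\<in>O'. [:- s, 1:]) i \<in> E)"
    using assms
  proof induction
    case (insert s O')
    then show ?case
      using map_poly_linear_mult[of "\<Prod>s\<in>O'. [:- s, 1:]" s]
      by (simp only: prod.insert[OF insert.hyps] insert_subset) simp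
  qed (simp add: one_pCons coeff_pCons map_poly_pCons split: nat.split)
  then show "map_poly \<sigma> (\<Prod>s\<in>O'. [:- s, 1:]) = (\<Prod>s\<in>O'. [:- \<sigma> s, 1:])"
    "coeff (\<Prod>s\<in>O'. [:- s, 1:]) i \<in> E"
    by blast+
qed

end

text \<open>The fixed field of \<sigma> is exactly K, as for a generator of a cyclic Galois group.
  The results that follow are Artin's argument for this situation.\<close>

locale fixed_K_endomorphism = K_endomorphism +
  assumes fixed: "y \<in> E \<Longrightarrow> \<sigma> y = y \<Longrightarrow> y \<in> range to_ac"
begin

text \<open>\<sigma> permutes the orbit and hence fixes the coefficients of the product, which
  therefore come from K.\<close>

lemma orbit_poly:
  assumes y: "y \<in> E"
  obtains h where "map_poly to_ac h = (\<Prod>s\<in>orbit y. [:- s, 1:])"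
proof -
  define P where "P = (\<Prod>s\<in>orbit y. [:- s, 1:])"
  note * = map_poly_prod_linear[OF finite_orbit[OF y] orbit_subset_E[OF y], folded P_def]
  have "map_poly \<sigma> P = (\<Prod>s\<in>\<sigma> ` orbit y. [:- s, 1:])"
    unfolding * by (simp add: prod.reindex[OF inj_on_subset[OF inj orbit_subset_E[OF y]]])
  then have "map_poly \<sigma> P = P"
    by (simp add: image_orbit[OF y] P_def)
  then have "\<sigma> (coeff P i) = coeff P i" for i
    by (metis coeff_map_poly zero)
  then have "coeff P i \<in> range to_ac" for i
    using fixed *(2) by blast
  then have "map_poly to_ac (map_poly of_ac P) = P"
    by (intro poly_eqI) (simp add: coeff_map_poly to_ac_of_ac)
  then show ?thesis
    using that P_def by blast
qed

lemma irreducible_dvd_orbit_poly: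
  assumes y: "y \<in> E" and f: "irreducible f" "ev f y = 0"
  shows "map_poly to_ac f dvd (\<Prod>s\<in>orbit y. [:- s, 1:])"
proof -
  obtain h where h: "map_poly to_ac h = (\<Prod>s\<in>orbit y. [:- s, 1:])"
    using orbit_poly[OF y] .
  have "ev h y = 0"
    unfolding h using finite_orbit[OF y] self_in_orbit by (auto simp: poly_prod)
  then have "f dvd h"
    by (simp add: irreducible_dvd_iff_ev[OF f])
  then have "map_poly to_ac f dvd map_poly to_ac h"
    by (auto elim!: dvdE)
  then show ?thesis
    by (simp add: h)
qed

lemma roots_in_orbit:
  assumes "y \<in> E" "irreducible f" "ev f y = 0" "ev f z = 0"
  shows "z \<in> orbit y"
proof -
  have "poly (\<Prod>s\<in>orbit y. [:- s, 1:]) z = 0"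
    using irreducible_dvd_orbit_poly[OF assms(1-3)] assms(4) by (metis dvdE mult_zero_left poly_mult)
  then show ?thesis
    using finite_orbit[OF assms(1)] by (auto simp: poly_prod)
qed

lemma card_orbit:
  assumes "y \<in> E"
  shows "card (orbit y) = degree (min_poly y)"
proof (rule antisym)
  have "card (orbit y) \<le> card {z. ev (min_poly y) z = 0}"
    by (intro card_mono finite_roots_min_poly orbit_subset_roots assms)
  then show "card (orbit y) \<le> degree (min_poly y)"
    using card_roots_min_poly le_trans by blast
  have "degree (map_poly to_ac (min_poly y)) \<le> degree (\<Prod>s\<in>orbit y. [:- s, 1:])"
    using irreducible_dvd_orbit_poly[OF assms irreducible_min_poly]
    by (intro dvd_imp_degree_le) (auto simp: finite_orbit[OF assms])
  then show "degree (min_poly y) \<le> card (orbit y)"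
    by (simp add: degree_prod_sum_eq)
qed

lemma normal: "normal_extension E"
  unfolding normal_extension_def using roots_in_orbit orbit_subset_E by blast

lemma separable: "E \<subseteq> separable_closure"
proof
  fix y assume y: "y \<in> E"
  \<comment> \<open>The minimal polynomial divides the orbit polynomial, a product of distinct
    linear factors, so no root can be multiple.\<close>
  have "order a (map_poly to_ac (min_poly y)) \<le> 1" for a
  proof -
    have "order a (\<Prod>s\<in>S. [:- s, 1:]) \<le> (if a \<in> S then 1 else 0)" if "finite S" for S :: "'a alg_closure set"
      using that
    proof induction
      case (insert s S)
      have "order a [:- s, 1:] = (if a = s then 1 else 0)"
        using order_power_n_n[of s 1] by (auto intro: order_0I)
      moreover have "order a ([:- s, 1:] * (\<Prod>s\<in>S. [:- s, 1:])) =
          order a [:- s, 1:] + order a (\<Prod>s\<in>S. [:- s, 1:])"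
        using insert by (intro order_mult) (simp del: mult_pCons_left)
      ultimately show ?case
        using insert by (simp only: prod.insert) (auto split: if_splits)
    qed simp
    from this[OF finite_orbit[OF y]] have "order a (\<Prod>s\<in>orbit y. [:- s, 1:]) \<le> 1"
      by (meson le_trans le_refl zero_le_one if_split)
    moreover have "order a (map_poly to_ac (min_poly y)) \<le> order a (\<Prod>s\<in>orbit y. [:- s, 1:])"
      using irreducible_dvd_orbit_poly[OF y irreducible_min_poly]
      by (intro dvd_imp_order_le) (auto simp: finite_orbit[OF y])
    ultimately show ?thesis
      by simp
  qed
  then have "rsquarefree (map_poly to_ac (min_poly y))"
    by (auto simp: rsquarefree_def le_Suc_eq)
  then show "y \<in> separable_closure"
    unfolding separable_closure_def using irreducible_min_poly ev_min_poly by blast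
qed

lemma galois: "galois_extension E"
  by (simp add: galois_extension_def E separable normal)

text \<open>The orbit size is the least period of \<open>y\<close>, and it equals the degree of
  \<open>y\<close> by \<open>card_orbit\<close>. This provides the relation \<sigma>^p = 1 on a
  generator of an extension of degree p.\<close>

lemma funpow_degree:
  assumes y: "y \<in> E"
  shows "(\<sigma> ^^ degree (min_poly y)) y = y"
proof -
  have inj_funpow: "(\<sigma> ^^ i) u = (\<sigma> ^^ i) v \<Longrightarrow> u = v" if "u \<in> E" "v \<in> E" for i u v
    using that by (induction i) (auto dest!: inj_onD[OF inj] simp: funpow_in_E)
  have "\<exists>r>0. (\<sigma> ^^ r) y = y"
  proof -
    have "\<not> inj (\<lambda>i. (\<sigma> ^^ i) y)"
      using finite_orbit[OF y] finite_imageD[of "\<lambda>i. (\<sigma> ^^ i) y" UNIV] by (auto simp: orbit_def)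
    then obtain i j where "i < j" "(\<sigma> ^^ i) y = (\<sigma> ^^ j) y"
      by (metis linorder_injI)
    then have "(\<sigma> ^^ i) y = (\<sigma> ^^ i) ((\<sigma> ^^ (j - i)) y)"
      by (simp flip: funpow_add comp_apply[of "\<sigma> ^^ i"])
    then have "y = (\<sigma> ^^ (j - i)) y"
      using inj_funpow y funpow_in_E by blast
    with \<open>i < j\<close> show ?thesis
      by (intro exI[of _ "j - i"]) auto
  qed
  define r where "r = (LEAST r. r > 0 \<and> (\<sigma> ^^ r) y = y)"
  have r: "r > 0" "(\<sigma> ^^ r) y = y" and least: "\<And>s. s > 0 \<Longrightarrow> (\<sigma> ^^ s) y = y \<Longrightarrow> r \<le> s"
    using LeastI_ex[OF \<open>\<exists>r>0. (\<sigma> ^^ r) y = y\<close>] Least_le[of "\<lambda>r. r > 0 \<and> (\<sigma> ^^ r) y = y"]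
    by (auto simp: r_def)
  have "orbit y = (\<lambda>i. (\<sigma> ^^ i) y) ` {..<r}"
  proof -
    have "(\<sigma> ^^ i) y = (\<sigma> ^^ (i mod r)) y" for i
      using funpow_mod_eq[OF r(2)] by simp
    moreover have "i mod r < r" for i
      using r(1) by simp
    ultimately show ?thesis
      unfolding orbit_def by blast
  qed
  moreover have "inj_on (\<lambda>i. (\<sigma> ^^ i) y) {..<r}"
  proof (rule linorder_inj_onI)
    fix i j assume ij: "i < j" "i \<in> {..<r}" "j \<in> {..<r}"
    show "(\<sigma> ^^ i) y \<noteq> (\<sigma> ^^ j) y"
    proof
      assume "(\<sigma> ^^ i) y = (\<sigma> ^^ j) y"
      then have "(\<sigma> ^^ i) y = (\<sigma> ^^ i) ((\<sigma> ^^ (j - i)) y)"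
        using ij by (simp flip: funpow_add comp_apply[of "\<sigma> ^^ i"])
      then have "y = (\<sigma> ^^ (j - i)) y"
        using inj_funpow y funpow_in_E by blast
      then show False
        using least[of "j - i"] ij by auto
    qed
  qed auto
  ultimately have "card (orbit y) = r"
    by (simp add: card_image)
  then show ?thesis
    using r(2) by (simp add: card_orbit[OF y])
qed

end

text \<open>A fixed element outside K would generate \<open>E\<close>, so \<sigma> would be the
  identity.\<close>

lemma fixed_K_endomorphism_prime_degree:
  assumes "K_endomorphism E \<sigma>" and p: "prime (extension_degree E)" and x: "x \<in> E" "\<sigma> x \<noteq> x"
  shows "fixed_K_endomorphism E \<sigma>"
proof -
  interpret K_endomorphism E \<sigma>
    by fact
  show ?thesis
  proof
    fix y assume y: "y \<in> E" "\<sigma> y = y"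
    show "y \<in> range to_ac"
    proof (rule ccontr)
      assume "y \<notin> range to_ac"
      then have "gen y = E"
        using prime_degree_gen[OF E p y(1)] by blast
      then obtain f where "x = ev f y"
        using x(1) by (metis gen_cases)
      then have "\<sigma> x = x"
        using ev[OF y(1)] y(2) by simp
      with x(2) show False ..
    qed
  qed
qed

lemma exists_K_endomorphism:
  fixes x x' :: "'k::field alg_closure"
  assumes x': "ev (min_poly x) x' = 0" "x' \<in> gen x"
  obtains \<sigma> where "K_endomorphism (gen x) \<sigma>" "\<sigma> x = x'"
proof -
  \<comment> \<open>The map f(x) \<mapsto> f(x') on K[X] modulo the minimal polynomial; two choices
    of \<open>f\<close> differ by a multiple of \<open>min_poly x\<close>, which vanishes at
    \<open>x'\<close> too.\<close>
  define \<sigma> where "\<sigma> y = ev (SOME f. ev f x = y) x'" for y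
  have \<sigma>: "\<sigma> (ev f x) = ev f x'" for f
  proof -
    define g where "g = (SOME g. ev g x = ev f x)"
    have "ev g x = ev f x"
      unfolding g_def by (rule someI[of _ f]) simp
    then have "ev (g - f) x = 0"
      by simp
    then obtain h where "g - f = min_poly x * h"
      unfolding ev_eq_0_iff by (rule dvdE)
    then have "ev (g - f) x' = 0"
      using x' by (simp only: map_poly_to_ac_mult poly_mult) simp
    then show ?thesis
      by (simp add: \<sigma>_def g_def)
  qed
  have "K_endomorphism (gen x) \<sigma>"
  proof
    show "intermediate_field (gen x)"
      by (rule intermediate_field_gen)
    show "\<sigma> y \<in> gen x" if "y \<in> gen x" for y
      using that gen_subset_intermediate_field[OF intermediate_field_gen x'(2)] \<sigma>
      by (metis gen_cases ev_in_gen subsetD)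
    show "\<sigma> (to_ac c) = to_ac c" for c
      using \<sigma>[of "[:c:]"] by simp
    fix y z assume "y \<in> gen x" "z \<in> gen x"
    then obtain f g where fg: "y = ev f x" "z = ev g x"
      by (metis gen_cases)
    show "\<sigma> (y + z) = \<sigma> y + \<sigma> z" "\<sigma> (y * z) = \<sigma> y * \<sigma> z"
      using \<sigma>[of "f + g"] \<sigma>[of "f * g"] by (simp_all add: fg \<sigma>)
  qed
  moreover have "\<sigma> x = x'"
    using \<sigma>[of "[:0, 1:]"] by simp
  ultimately show ?thesis
    using that by blast
qed

section \<open>Artin--Schreier theory\<close>

definition AS_poly :: "'k::field \<Rightarrow> 'k poly" where
  "AS_poly a = monom 1 (CHAR('k)) - [:a, 1:]"

lemma ev_AS_poly: "ev (AS_poly a) x = wp x - to_ac a"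
  by (simp add: AS_poly_def wp_def poly_monom)

lemma degree_AS_poly:
  assumes p: "prime CHAR('k::field)"
  shows "degree (AS_poly (a :: 'k)) = CHAR('k)"
proof (rule antisym)
  have p1: "CHAR('k) > 1"
    using p prime_gt_1_nat by blast
  then show "degree (AS_poly a) \<le> CHAR('k)"
    unfolding AS_poly_def by (intro degree_diff_le) (auto intro: degree_monom_le)
  have "coeff (AS_poly a) (CHAR('k)) = 1"
    using p1 by (cases "CHAR('k)") (auto simp: AS_poly_def coeff_pCons split: nat.split)
  then show "CHAR('k) \<le> degree (AS_poly a)"
    by (intro le_degree) simp
qed

lemma exists_wp_root:
  fixes a :: "'k::field"
  assumes p: "prime CHAR('k)"
  shows "\<exists>\<alpha>. wp \<alpha> = to_ac a"
proof -
  have "degree (map_poly to_ac (AS_poly a)) > 0"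
    using degree_AS_poly[OF p, of a] prime_gt_0_nat[OF p] by simp
  then obtain \<alpha> where "ev (AS_poly a) \<alpha> = 0"
    using alg_closed_imp_poly_has_root by blast
  then show ?thesis
    by (intro exI[of _ \<alpha>]) (simp add: ev_AS_poly)
qed

text \<open>
  If \<open>\<alpha>\<close> had degree \<open>d < p\<close>, then applying Frobenius to the coefficients of its minimal polynomial and
  substituting \<open>\<alpha>\<^sup>p = \<alpha> + a\<close> would reproduce that polynomial; comparing coefficients in degree \<open>d - 1\<close>
  exhibits \<open>d a\<close> as an element of \<open>range wp\<close>.
\<close>
lemma degree_min_poly_wp_root:
  fixes \<alpha> :: "'k::field alg_closure"
  assumes p: "prime CHAR('k)" and \<alpha>: "wp \<alpha> = to_ac a" and a: "a \<notin> range wp"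
  shows "degree (min_poly \<alpha>) = CHAR('k)"
proof (rule ccontr)
  define d where "d = degree (min_poly \<alpha>)"
  define c where "c i = coeff (min_poly \<alpha>) i" for i
  assume "degree (min_poly \<alpha>) \<noteq> CHAR('k)"
  moreover have "AS_poly a \<noteq> 0"
    using degree_AS_poly[OF p, of a] prime_gt_0_nat[OF p] by auto
  then have "d \<le> CHAR('k)"
    using degree_min_poly_le[of "AS_poly a" \<alpha>] \<alpha> degree_AS_poly[OF p, of a]
    by (simp add: ev_AS_poly d_def)
  ultimately have d: "0 < d" "d < CHAR('k)"
    using degree_min_poly_pos[of \<alpha>] unfolding d_def by linarith+
  have cd: "c d = 1"
    using lead_coeff_min_poly[of \<alpha>] by (simp add: c_def d_def)
  \<comment> \<open>The minimal polynomial with coefficients raised to the p-th power and X + a put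
    for X. Its value at \<alpha> is the p-th power of
    \<open>ev (min_poly \<alpha>) \<alpha>\<close>, hence 0; being monic of the same degree, it must
    be \<open>min_poly \<alpha>\<close>.\<close>
  define h where "h = (\<Sum>i\<le>d. smult (c i ^ CHAR('k)) ([:a, 1:] ^ i))"
  have \<alpha>p: "\<alpha> ^ CHAR('k) = \<alpha> + to_ac a"
    using \<alpha> by (simp add: wp_def algebra_simps)
  have "ev h \<alpha> = (\<Sum>i\<le>d. to_ac (c i) * \<alpha> ^ i) ^ CHAR('k)"
  proof -
    have "(\<Sum>i\<le>d. to_ac (c i) * \<alpha> ^ i) ^ CHAR('k) = (\<Sum>i\<le>d. (to_ac (c i) * \<alpha> ^ i) ^ CHAR('k))"
      by (rule freshmans_dream_sum) (simp_all add: p)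
    also have "\<dots> = (\<Sum>i\<le>d. to_ac (c i) ^ CHAR('k) * (to_ac a + \<alpha>) ^ i)"
      by (intro sum.cong refl)
         (metis \<alpha>p add.commute mult.commute power_mult power_mult_distrib)
    also have "\<dots> = ev h \<alpha>"
      by (simp add: h_def poly_sum poly_power)
    finally show ?thesis ..
  qed
  also have "(\<Sum>i\<le>d. to_ac (c i) * \<alpha> ^ i) = 0"
    using ev_min_poly[of \<alpha>] by (simp add: poly_altdef coeff_map_poly d_def c_def)
  finally have h_root: "ev (h - min_poly \<alpha>) \<alpha> = 0"
    using prime_gt_0_nat[OF p] by (simp add: power_0_left)
  have coeff_h: "coeff h j = (\<Sum>i\<le>d. c i ^ CHAR('k) * coeff ([:a, 1:] ^ i) j)" for j
    by (simp add: h_def coeff_sum)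
  have zero: "coeff ([:a, 1:] ^ i) j = 0" if "i < j" for i j
    using that by (intro coeff_eq_0) (simp add: degree_linear_power)
  have "coeff h j = coeff (min_poly \<alpha>) j" if "j \<ge> d" for j
  proof (cases "j = d")
    case True
    have "coeff h d = (\<Sum>i\<in>{d}. c i ^ CHAR('k) * coeff ([:a, 1:] ^ i) d)"
      unfolding coeff_h by (intro sum.mono_neutral_right) (auto simp: zero)
    then show ?thesis
      using cd True by (simp add: coeff_linear_power c_def)
  next
    case False
    then show ?thesis
      using that by (simp add: coeff_h zero coeff_eq_0 d_def)
  qed
  then have "h - min_poly \<alpha> = 0 \<or> degree (h - min_poly \<alpha>) < d"
    by (metis coeff_diff diff_self leading_coeff_0_iff not_le)
  then have "h - min_poly \<alpha> = 0"
    using degree_min_poly_le[OF _ h_root] unfolding d_def by (meson not_le)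
  then have h: "h = min_poly \<alpha>"
    by simp
  obtain e where e: "d = Suc e"
    using d by (cases d) auto
  have "c e = coeff h e"
    by (simp add: h c_def)
  also have "\<dots> = (\<Sum>i\<in>{e, Suc e}. c i ^ CHAR('k) * coeff ([:a, 1:] ^ i) e)"
    unfolding coeff_h e by (intro sum.mono_neutral_right) (auto simp: zero le_Suc_eq)
  also have "\<dots> = c e ^ CHAR('k) + of_nat d * a"
    using cd e by (simp add: coeff_linear_power coeff_linear_poly_power del: power_Suc)
  finally have "of_nat d * a = - wp (c e)"
    by (simp add: wp_def algebra_simps)
  also have "\<dots> \<in> range wp"
    by (intro range_wp_minus[OF p]) simp
  finally obtain t where t: "of_nat d * a = wp t"
    by blast
  have "(of_nat d :: 'k) \<noteq> 0"
    using d by (simp add: of_nat_eq_0_iff_char_dvd nat_dvd_not_less)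
  \<comment> \<open>A nonzero \<open>of_nat d\<close> satisfies d^p = d, so division by it commutes
    with \<open>wp\<close>.\<close>
  then have "a = wp (t / of_nat d)"
    using t by (simp add: wp_def power_divide of_nat_power_char[OF p] field_simps)
  with a show False
    by blast
qed

text \<open>The minimal polynomial has the full degree p, so \<open>AS_poly a\<close> is a constant
  multiple of it, and the root \<alpha> + 1 of the latter is a conjugate of \<alpha>.\<close>

lemma AS_endomorphism:
  fixes \<alpha> :: "'k::field alg_closure"
  assumes p: "prime CHAR('k)" and \<alpha>: "wp \<alpha> = to_ac a" and a: "a \<notin> range wp"
  obtains \<sigma> where "fixed_K_endomorphism (gen \<alpha>) \<sigma>" "\<sigma> \<alpha> = \<alpha> + 1"
proof -
  have dvd: "min_poly \<alpha> dvd AS_poly a"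
    using \<alpha> by (simp add: ev_AS_poly flip: ev_eq_0_iff)
  then obtain q where q: "AS_poly a = min_poly \<alpha> * q"
    by (rule dvdE)
  have "AS_poly a \<noteq> 0"
    using degree_AS_poly[OF p, of a] prime_gt_0_nat[OF p] by auto
  then have "q \<noteq> 0"
    using q by auto
  then have "degree q = 0"
    using degree_min_poly_wp_root[OF assms] degree_AS_poly[OF p, of a] arg_cong[OF q, of degree]
    by (simp add: degree_mult_eq)
  then obtain c where c: "q = [:c:]" "c \<noteq> 0"
    using \<open>q \<noteq> 0\<close> by (auto elim: degree_eq_zeroE)
  have "ev (AS_poly a) (\<alpha> + 1) = 0"
    using \<alpha> p by (simp add: ev_AS_poly wp_add)
  then have "ev (min_poly \<alpha>) (\<alpha> + 1) = 0"
    using c by (simp add: q)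
  moreover have "\<alpha> + 1 \<in> gen \<alpha>"
    using gen_add[OF gen_self to_ac_in_gen[of 1]] by simp
  ultimately obtain \<sigma> where \<sigma>: "K_endomorphism (gen \<alpha>) \<sigma>" "\<sigma> \<alpha> = \<alpha> + 1"
    using exists_K_endomorphism by blast
  then have "fixed_K_endomorphism (gen \<alpha>) \<sigma>"
    using p by (intro fixed_K_endomorphism_prime_degree[of _ _ \<alpha>])
      (auto simp: extension_degree_gen degree_min_poly_wp_root[OF assms])
  with \<sigma> that show ?thesis
    by blast
qed

lemma artin_schreier_extension_gen:
  fixes \<alpha> :: "'k::field alg_closure"
  assumes "prime CHAR('k)" "wp \<alpha> = to_ac a" "a \<notin> range wp"
  shows "artin_schreier_extension (gen \<alpha>)"
proof -
  obtain \<sigma> where "fixed_K_endomorphism (gen \<alpha>) \<sigma>"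
    using AS_endomorphism[OF assms] by blast
  then interpret fixed_K_endomorphism "gen \<alpha>" \<sigma> .
  show ?thesis
    by (simp add: artin_schreier_extension_def galois extension_degree_gen degree_min_poly_wp_root[OF assms])
qed

text \<open>If a - b = wp(t), then \<alpha> and \<beta> + t have the same image under
  \<open>wp\<close> and differ by an element of F_p; adjoining either gives the same field.\<close>

lemma gen_eq_if_congruent:
  fixes \<alpha> \<beta> :: "'k::field alg_closure"
  assumes p: "prime CHAR('k)" and \<alpha>: "wp \<alpha> = to_ac a" and \<beta>: "wp \<beta> = to_ac b" and ab: "a - b \<in> range wp"
  shows "gen \<alpha> = gen \<beta>"
proof -
  obtain t where "a - b = wp t"
    using ab by blast
  then have "wp \<alpha> = wp (\<beta> + to_ac t)"
    using p \<alpha> \<beta> by (simp add: wp_add wp_to_ac flip: to_ac_add) (metis add.commute diff_add_cancel)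
  then obtain i where "\<alpha> = \<beta> + to_ac t + of_nat i"
    using p by (auto simp: wp_eq_iff)
  then have \<alpha>\<beta>: "\<alpha> = \<beta> + to_ac (t + of_nat i)" "\<beta> = \<alpha> + to_ac (- (t + of_nat i))"
    by simp_all
  show ?thesis
  proof
    show "gen \<alpha> \<subseteq> gen \<beta>"
      by (intro gen_subset_intermediate_field intermediate_field_gen)
         (subst \<alpha>\<beta>(1), intro gen_add gen_self to_ac_in_gen)
    show "gen \<beta> \<subseteq> gen \<alpha>"
      by (intro gen_subset_intermediate_field intermediate_field_gen)
         (subst \<alpha>\<beta>(2), intro gen_add gen_self to_ac_in_gen)
  qed
qed

text \<open>\<sigma> moves \<beta> by some i in F_p and \<alpha> by 1, so \<beta> - i \<alpha> is
  fixed and lies in K; applying \<open>wp\<close> gives the congruence. Hence at most p classes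
  share one extension.\<close>

lemma congruent_multiple_if_gen_eq:
  fixes \<alpha> \<beta> :: "'k::field alg_closure"
  assumes p: "prime CHAR('k)" and \<alpha>: "wp \<alpha> = to_ac a" "a \<notin> range wp"
    and \<beta>: "wp \<beta> = to_ac b" and eq: "gen \<alpha> = gen \<beta>"
  shows "\<exists>i<CHAR('k). b - of_nat i * a \<in> range wp"
proof -
  obtain \<sigma> where \<sigma>: "fixed_K_endomorphism (gen \<alpha>) \<sigma>" "\<sigma> \<alpha> = \<alpha> + 1"
    using AS_endomorphism[OF p \<alpha>] by blast
  interpret fixed_K_endomorphism "gen \<alpha>" \<sigma>
    by fact
  have \<beta>_in: "\<beta> \<in> gen \<alpha>"
    by (simp add: eq)
  have "wp (\<sigma> \<beta>) = wp \<beta>"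
    using wp[OF \<beta>_in] by (simp add: \<beta>)
  then obtain i where i: "i < CHAR('k)" "\<sigma> \<beta> = \<beta> + of_nat i"
    using p by (auto simp: wp_eq_iff)
  have i_in: "of_nat i \<in> gen \<alpha>" and i_fixed: "\<sigma> (of_nat i) = of_nat i"
    using base_in_E[of "of_nat i"] fixes_base[of "of_nat i"] by simp_all
  define \<gamma> where "\<gamma> = \<beta> - of_nat i * \<alpha>"
  have "\<sigma> \<gamma> = \<gamma>"
    using i_in \<beta>_in \<sigma>(2) i(2) by (simp add: \<gamma>_def diff mult mult_in_E i_fixed algebra_simps)
  moreover have "\<gamma> \<in> gen \<alpha>"
    unfolding \<gamma>_def using i_in \<beta>_in by (intro diff_in_E mult_in_E) auto
  ultimately obtain t where t: "\<gamma> = to_ac t"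
    using fixed by blast
  have "wp (of_nat j * x) = of_nat j * wp x" for j and x :: "'k alg_closure"
    using p by (induction j) (auto simp: wp_add distrib_right)
  then have "to_ac (wp t) = to_ac (b - of_nat i * a)"
    using p \<alpha>(1) \<beta> by (simp add: wp_diff \<gamma>_def flip: wp_to_ac t)
  then have "b - of_nat i * a = wp t"
    by (simp only: to_ac_eq_iff)
  with i(1) show ?thesis
    by blast
qed

text \<open>Polynomials act on the field with X acting as \<sigma>. Identities between powers of
  \<sigma> and \<sigma> - 1 can then be taken from the polynomial ring.\<close>

definition act :: "('k::field alg_closure \<Rightarrow> 'k alg_closure) \<Rightarrow> 'k alg_closure poly \<Rightarrow>
    'k alg_closure \<Rightarrow> 'k alg_closure" where
  "act \<sigma> q y = (\<Sum>i\<le>degree q. coeff q i * (\<sigma> ^^ i) y)"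

lemma act_altdef: "degree q \<le> n \<Longrightarrow> act \<sigma> q y = (\<Sum>i\<le>n. coeff q i * (\<sigma> ^^ i) y)"
  unfolding act_def by (rule sum.mono_neutral_left) (auto simp: coeff_eq_0)

lemma act_diff: "act \<sigma> (q - r) y = act \<sigma> q y - act \<sigma> r y"
proof -
  define n where "n = max (degree q) (degree r)"
  have "degree (q - r) \<le> n" "degree q \<le> n" "degree r \<le> n"
    by (auto simp: n_def intro: degree_diff_le)
  then show ?thesis
    by (simp add: act_altdef[of _ n] left_diff_distrib sum_subtractf)
qed

lemma act_pCons_0: "act \<sigma> (pCons 0 q) y = act \<sigma> q (\<sigma> y)"
proof -
  have "act \<sigma> (pCons 0 q) y = (\<Sum>i\<le>Suc (degree q). coeff (pCons 0 q) i * (\<sigma> ^^ i) y)"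
    by (rule act_altdef) (simp add: degree_pCons_le)
  then show ?thesis
    by (subst (asm) sum.atMost_Suc_shift) (simp add: act_def funpow_Suc_right del: funpow.simps)
qed

lemma act_monom: "act \<sigma> (monom 1 n) y = (\<sigma> ^^ n) y"
  by (subst act_altdef[of _ n]) (auto simp: degree_monom_le if_distrib[of "\<lambda>c. c * _"] cong: if_cong)

context K_endomorphism
begin

lemma funpow_diff: "y \<in> E \<Longrightarrow> z \<in> E \<Longrightarrow> (\<sigma> ^^ i) (y - z) = (\<sigma> ^^ i) y - (\<sigma> ^^ i) z"
  by (induction i) (auto simp: diff funpow_in_E)

lemma delta_in_E: "y \<in> E \<Longrightarrow> ((\<lambda>y. \<sigma> y - y) ^^ n) y \<in> E"
  by (induction n) (auto intro!: diff_in_E closed)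

lemma act_delta_power:
  assumes "y \<in> E"
  shows "act \<sigma> ([:-1, 1:] ^ n) y = ((\<lambda>y. \<sigma> y - y) ^^ n) y"
  using assms
proof (induction n arbitrary: y)
  case 0
  then show ?case
    by (simp add: act_def)
next
  case (Suc n)
  have "[:-1, 1:] ^ Suc n = pCons 0 ([:-1, 1:] ^ n) - [:-1, 1 :: 'k alg_closure:] ^ n"
    by simp
  then have "act \<sigma> ([:-1, 1:] ^ Suc n) y = act \<sigma> ([:-1, 1:] ^ n) (\<sigma> y) - act \<sigma> ([:-1, 1:] ^ n) y"
    by (simp only: act_diff act_pCons_0)
  also have "\<dots> = act \<sigma> ([:-1, 1:] ^ n) (\<sigma> y - y)"
    using Suc.prems by (simp add: act_def funpow_diff closed right_diff_distrib sum_subtractf)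
  also have "\<dots> = ((\<lambda>y. \<sigma> y - y) ^^ Suc n) y"
    using Suc.IH[of "\<sigma> y - y"] Suc.prems by (simp add: diff_in_E closed funpow_Suc_right del: funpow.simps)
  finally show ?case .
qed

lemma delta_power_char:
  assumes p: "prime CHAR('k)" and y: "y \<in> E"
  shows "((\<lambda>y. \<sigma> y - y) ^^ CHAR('k)) y = (\<sigma> ^^ CHAR('k)) y - y"
proof -
  have "[:-1, 1:] = monom 1 1 - (1 :: 'k alg_closure poly)"
    by (simp add: monom_altdef one_pCons)
  \<comment> \<open>Frobenius in the polynomial ring, which has characteristic p itself: (X - 1)^p =
    X^p - 1.\<close>
  moreover have "(monom 1 1 - 1) ^ CHAR('k) = monom 1 (CHAR('k)) - (1 :: 'k alg_closure poly)"
  proof -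
    have *: "CHAR('k alg_closure poly) = CHAR('k)"
      by simp
    show ?thesis
      using power_char_diff[of "monom 1 1" "1 :: 'k alg_closure poly", unfolded *, OF p]
      by (simp only: monom_power power_one mult_1)
  qed
  ultimately have "[:-1, 1:] ^ CHAR('k) = monom 1 (CHAR('k)) - (1 :: 'k alg_closure poly)"
    by (simp only:)
  then show ?thesis
    using act_delta_power[OF y, of "CHAR('k)"] act_monom[of \<sigma> 0 y] by (simp add: act_diff act_monom)
qed

end

text \<open>
  With \<open>\<sigma>\<close> a generator of the Galois group, \<open>\<sigma> - 1\<close> is nilpotent since \<open>(\<sigma> - 1)\<^sup>p = \<sigma>\<^sup>p - 1 = 0\<close>, and its kernel is
  the base field; dividing by the last nonzero iterate, one gets \<open>\<alpha>\<close> with \<open>\<sigma> \<alpha> = \<alpha> + 1\<close>.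
\<close>
lemma artin_schreier_extension_cases:
  fixes E :: "'k::field alg_closure set"
  assumes p: "prime CHAR('k)" and AS: "artin_schreier_extension E"
  obtains \<alpha> a where "E = gen \<alpha>" "wp \<alpha> = to_ac a" "a \<notin> range wp"
proof -
  have E: "intermediate_field E" and sep: "E \<subseteq> separable_closure" and normal: "normal_extension E"
    and deg: "extension_degree E = CHAR('k)"
    using AS by (auto simp: artin_schreier_extension_def galois_extension_def)
  have prime: "prime (extension_degree E)"
    using p deg by simp
  have "\<not> E \<subseteq> range to_ac"
  proof
    assume "E \<subseteq> range to_ac"
    then have "E \<subseteq> ac.span {1}"
      by (auto simp: ac.span_singleton)
    then have "extension_degree E \<le> card {1 :: 'k alg_closure}"
      unfolding extension_degree_def by (rule ac.dim_le_card) simp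
    then show False
      using prime_gt_1_nat[OF prime] by simp
  qed
  then obtain \<beta> where \<beta>: "\<beta> \<in> E" "\<beta> \<notin> range to_ac"
    by blast
  note gen\<beta> = prime_degree_gen[OF E prime \<beta>]
  obtain f where f: "irreducible f" "rsquarefree (map_poly to_ac f)" "ev f \<beta> = 0"
    using sep \<beta>(1) by (auto simp: separable_closure_def)
  obtain q where q: "map_poly to_ac f = [:- \<beta>, 1:] * q"
    using f(3) by (auto simp: poly_eq_0_iff_dvd elim!: dvdE)
  have f0: "map_poly to_ac f \<noteq> 0"
    using f(2) by (simp add: rsquarefree_def)
  have "degree f \<ge> degree (min_poly \<beta>)"
    using f0 f(3) by (intro degree_min_poly_le) auto
  then have "degree f \<ge> 2"
    using gen\<beta>(1) prime_ge_2_nat[OF prime] by simp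
  moreover have "degree (map_poly to_ac f) = degree [:- \<beta>, 1:] + degree q"
    unfolding q using f0 q by (intro degree_mult_eq) auto
  ultimately have "degree q > 0"
    by simp
  \<comment> \<open>A second root of \<open>f\<close>: squarefreeness will separate it from \<beta>,
    and normality will put it into \<open>E\<close>. Sending \<beta> to it yields a nontrivial
    endomorphism.\<close>
  then obtain \<beta>' where \<beta>': "poly q \<beta>' = 0"
    using alg_closed_imp_poly_has_root by blast
  have "order \<beta> (map_poly to_ac f) = order \<beta> [:- \<beta>, 1:] + order \<beta> q"
    unfolding q using f0 q by (intro order_mult) simp
  moreover have "order \<beta> [:- \<beta>, 1:] = 1"
    using order_power_n_n[of \<beta> 1] by simp
  ultimately have "order \<beta> q = 0"
    using f(2) unfolding rsquarefree_def by (metis add_cancel_left_right add_is_0 one_neq_zero)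
  then have "\<beta>' \<noteq> \<beta>"
    using \<beta>' f0 q by (auto simp: order_root)
  have root': "ev f \<beta>' = 0"
    using \<beta>' by (simp add: q)
  then have "\<beta>' \<in> E"
    using normal f(1,3) \<beta>(1) unfolding normal_extension_def by blast
  moreover have "ev (min_poly \<beta>) \<beta>' = 0"
  proof -
    have "f dvd min_poly \<beta>"
      by (simp add: irreducible_dvd_iff_ev[OF f(1,3)])
    then show ?thesis
      using root' by (auto elim!: dvdE)
  qed
  ultimately obtain \<sigma> where \<sigma>: "K_endomorphism E \<sigma>" "\<sigma> \<beta> = \<beta>'"
    using exists_K_endomorphism[of \<beta> \<beta>'] gen\<beta>(2) by metis
  then interpret fixed_K_endomorphism E \<sigma>
    using \<open>\<beta>' \<noteq> \<beta>\<close> prime \<beta>(1) by (intro fixed_K_endomorphism_prime_degree) auto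
  define \<Delta> where "\<Delta> y = \<sigma> y - y" for y
  have "(\<sigma> ^^ CHAR('k)) \<beta> = \<beta>"
    using funpow_degree[OF \<beta>(1)] gen\<beta>(1) deg by simp
  then have nil: "(\<Delta> ^^ CHAR('k)) \<beta> = 0"
    using delta_power_char[OF p \<beta>(1)] by (simp add: \<Delta>_def[abs_def])
  have \<Delta>E: "(\<Delta> ^^ n) \<beta> \<in> E" for n
    using delta_in_E[OF \<beta>(1)] by (simp add: \<Delta>_def[abs_def])
  define m where "m = (LEAST n. (\<Delta> ^^ n) \<beta> = 0)"
  have m: "(\<Delta> ^^ m) \<beta> = 0" and least: "\<And>n. n < m \<Longrightarrow> (\<Delta> ^^ n) \<beta> \<noteq> 0"
    unfolding m_def using nil by (auto intro: LeastI dest: not_less_Least)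
  have "\<beta> \<noteq> 0"
    using \<beta>(2) by (metis rangeI to_ac_0)
  then have "m \<noteq> 0"
    using m by (cases m) auto
  moreover have "m \<noteq> Suc 0"
    using m fixed[OF \<beta>(1)] \<beta>(2) by (auto simp: \<Delta>_def)
  \<comment> \<open>At least two steps are needed to reach 0 from \<beta>: it is nonzero, and it is
    not fixed by \<sigma> since it lies outside K. So the element \<eta> two steps before 0 exists,
    and its image under \<Delta> is a nonzero constant.\<close>
  ultimately obtain n where n: "m = Suc (Suc n)"
    by (metis not0_implies_Suc)
  define \<eta> where "\<eta> = (\<Delta> ^^ n) \<beta>"
  have "\<Delta> \<eta> \<noteq> 0" "\<Delta> (\<Delta> \<eta>) = 0" and \<eta>E: "\<eta> \<in> E" "\<Delta> \<eta> \<in> E"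
    using m least[of "Suc n"] \<Delta>E[of n] \<Delta>E[of "Suc n"] by (auto simp: n \<eta>_def)
  have "\<Delta> \<eta> \<in> range to_ac"
    using fixed[OF \<eta>E(2)] \<open>\<Delta> (\<Delta> \<eta>) = 0\<close> by (simp add: \<Delta>_def[of "\<Delta> \<eta>"])
  with \<open>\<Delta> \<eta> \<noteq> 0\<close> obtain c where c: "\<Delta> \<eta> = to_ac c" "c \<noteq> 0"
    by force
  define \<alpha> where "\<alpha> = \<eta> * to_ac (inverse c)"
  have \<alpha>E: "\<alpha> \<in> E"
    unfolding \<alpha>_def using \<eta>E by (intro mult_in_E base_in_E)
  have "\<sigma> \<alpha> = (\<eta> + to_ac c) * to_ac (inverse c)"
    using mult[OF \<eta>E(1) base_in_E] c(1) by (simp add: \<alpha>_def \<Delta>_def algebra_simps del: to_ac_inverse)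
  then have \<sigma>\<alpha>: "\<sigma> \<alpha> = \<alpha> + 1"
    using c(2) by (simp add: \<alpha>_def distrib_right)
  then have "\<sigma> (wp \<alpha>) = wp \<alpha>"
    using p \<alpha>E by (simp add: wp wp_add)
  moreover have "wp \<alpha> \<in> E"
    unfolding wp_def using \<alpha>E by (intro diff_in_E intermediate_field_power[OF E])
  ultimately obtain a where a: "wp \<alpha> = to_ac a"
    using fixed by blast
  have \<alpha>_notin: "\<alpha> \<notin> range to_ac"
    using \<sigma>\<alpha> by auto
  have "a \<notin> range wp"
  proof
    assume "a \<in> range wp"
    then obtain t where "wp \<alpha> = wp (to_ac t)"
      using a by (auto simp: wp_to_ac)
    then obtain i where "\<alpha> = to_ac t + of_nat i"
      using p by (auto simp: wp_eq_iff)
    then have "\<alpha> = to_ac (t + of_nat i)"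
      by simp
    with \<alpha>_notin show False
      by blast
  qed
  then show ?thesis
    using that[of \<alpha> a] prime_degree_gen(2)[OF E prime \<alpha>E \<alpha>_notin] a by blast
qed

lemma exists_artin_schreier_extension_iff:
  assumes p: "prime CHAR('k::field)"
  shows "(\<exists>E :: 'k alg_closure set. artin_schreier_extension E) \<longleftrightarrow> range wp \<noteq> (UNIV :: 'k set)"
proof
  assume "\<exists>E :: 'k alg_closure set. artin_schreier_extension E"
  then obtain E :: "'k alg_closure set" where "artin_schreier_extension E" ..
  from p this obtain \<alpha> and a :: 'k where "a \<notin> range wp"
    by (rule artin_schreier_extension_cases)
  then show "range wp \<noteq> (UNIV :: 'k set)"
    by auto
next
  assume "range wp \<noteq> (UNIV :: 'k set)"
  then obtain a :: 'k where "a \<notin> range wp"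
    by blast
  moreover obtain \<alpha> where "wp \<alpha> = to_ac a"
    using exists_wp_root[OF p] ..
  ultimately have "artin_schreier_extension (gen \<alpha>)"
    by (intro artin_schreier_extension_gen[OF p])
  then show "\<exists>E :: 'k alg_closure set. artin_schreier_extension E" ..
qed

text \<open>The passage from nonzero classes of K / wp(K) to extensions is onto and has fibres of
  size at most p, so both sets are finite or infinite together.\<close>

lemma infinite_artin_schreier_extensions_iff:
  assumes p: "prime CHAR('k::field)"
  shows "infinite {E :: 'k alg_closure set. artin_schreier_extension E} \<longleftrightarrow>
         infinite (range (wp_rep :: 'k \<Rightarrow> 'k))"
proof -
  have "finite {E :: 'k alg_closure set. artin_schreier_extension E}"
    if fin: "finite (range (wp_rep :: 'k \<Rightarrow> 'k))"
  proof -
    have "\<exists>\<alpha> a. E = gen \<alpha> \<and> wp \<alpha> = to_ac a" if "artin_schreier_extension E" for E :: "'k alg_closure set"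
      using artin_schreier_extension_cases[OF p that] by metis
    then obtain \<alpha> a where \<alpha>: "\<And>E :: 'k alg_closure set. artin_schreier_extension E \<Longrightarrow>
        E = gen (\<alpha> E) \<and> wp (\<alpha> E) = to_ac (a E)"
      by metis
    have "inj_on (\<lambda>E. wp_rep (a E)) {E :: 'k alg_closure set. artin_schreier_extension E}"
      using \<alpha> gen_eq_if_congruent[OF p] by (intro inj_onI) (metis mem_Collect_eq wp_rep_eq_iff[OF p])
    then show ?thesis
      by (rule inj_on_finite[OF _ _ fin]) auto
  qed
  moreover have "finite (range (wp_rep :: 'k \<Rightarrow> 'k))"
    if fin: "finite {E :: 'k alg_closure set. artin_schreier_extension E}"
  proof (rule ccontr)
    assume inf: "infinite (range (wp_rep :: 'k \<Rightarrow> 'k))"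
    define R where "R = range (wp_rep :: 'k \<Rightarrow> 'k) - {wp_rep 0}"
    have "infinite R"
      using inf by (simp add: R_def)
    have rep: "wp_rep r = r" if "r \<in> R" for r
      using that p by (auto simp: R_def)
    have R: "r \<notin> range wp" if "r \<in> R" for r
      using that rep[OF that] wp_rep_eq_iff[OF p, of r 0] by (auto simp: R_def)
    obtain \<alpha> where \<alpha>: "\<And>a :: 'k. wp (\<alpha> a) = to_ac a"
      using exists_wp_root[OF p] by metis
    have "(\<lambda>a. gen (\<alpha> a)) ` R \<subseteq> {E. artin_schreier_extension E}"
      using artin_schreier_extension_gen[OF p \<alpha> R] by blast
    then have "finite ((\<lambda>a. gen (\<alpha> a)) ` R)"
      using fin finite_subset by blast
    \<comment> \<open>By the pigeonhole principle infinitely many nonzero classes would generate the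
      field of one \<open>r0\<close>, yet they all lie among the p multiples of its class.\<close>
    then obtain r0 where r0: "r0 \<in> R" "infinite {r \<in> R. gen (\<alpha> r) = gen (\<alpha> r0)}"
      using pigeonhole_infinite[OF \<open>infinite R\<close>] by blast
    have "{r \<in> R. gen (\<alpha> r) = gen (\<alpha> r0)} \<subseteq> (\<lambda>i. wp_rep (of_nat i * r0)) ` {..<CHAR('k)}"
    proof
      fix r assume r: "r \<in> {r \<in> R. gen (\<alpha> r) = gen (\<alpha> r0)}"
      then obtain i where i: "i < CHAR('k)" "r - of_nat i * r0 \<in> range wp"
        using congruent_multiple_if_gen_eq[OF p \<alpha> R[OF r0(1)] \<alpha>, of r] by auto
      then have "r = wp_rep (of_nat i * r0)"
        using rep[of r] r wp_rep_eq_iff[OF p, of r] by auto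
      with i(1) show "r \<in> (\<lambda>i. wp_rep (of_nat i * r0)) ` {..<CHAR('k)}"
        by blast
    qed
    then show False
      using r0(2) finite_subset by blast
  qed
  ultimately show ?thesis
    by blast
qed

theorem theorem1p1:
  fixes p :: nat and \<kappa> :: "'c rel"
  assumes "prime p"
    and "infinite (UNIV :: 'k::field set)" and "CHAR('k) = p"
    and "monster_model \<kappa> (Th TYPE('k)) TYPE('m::field)"
  shows "(\<forall>n\<ge>1. has_IP TYPE('m) n (AS_IP_form p n) \<longleftrightarrow>
             (\<exists>E :: 'k alg_closure set. artin_schreier_extension E)) \<and>
         (has_TP2 TYPE('m) 2 (AS_TP2_form p) \<longleftrightarrow>
             infinite {E :: 'k alg_closure set. artin_schreier_extension E})"
proof -
  have p: "prime CHAR('k)" and pk: "CHAR('k) = p"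
    using assms(1,3) by simp_all
  have models: "models TYPE('m) (Th TYPE('k))" and sat: "saturated \<kappa> TYPE('m)" and \<kappa>: "natLeq <o \<kappa>"
    using assms(4) by (auto simp: monster_model_def)
  have pm: "CHAR('m) = p" and prime_m: "prime CHAR('m)"
    using models_Th_CHAR[OF models p] pk assms(1) by simp_all
  have inf: "infinite (UNIV :: 'm set)"
    using assms(2) models_Th_infinite_iff[OF models] by simp
  have "has_IP TYPE('m) n (AS_IP_form p n) \<longleftrightarrow> (\<exists>E :: 'k alg_closure set. artin_schreier_extension E)"
    if "n \<ge> 1" for n
    using has_IP_if_range_wp_not_UNIV[OF prime_m inf sat \<kappa>, of n]
      not_has_IP_if_range_wp_UNIV[OF that, where 'm = 'm]
      models_Th_range_wp_iff[OF models p] exists_artin_schreier_extension_iff[OF p]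
    unfolding pm by argo
  moreover have "has_TP2 TYPE('m) 2 (AS_TP2_form p) \<longleftrightarrow>
      infinite {E :: 'k alg_closure set. artin_schreier_extension E}"
    using has_TP2_if_infinite_wp_rep[OF prime_m inf sat \<kappa>]
      not_has_TP2_if_finite_wp_rep[OF prime_m]
      models_Th_infinite_wp_rep_iff[OF models p] infinite_artin_schreier_extensions_iff[OF p]
    unfolding pm by argo
  ultimately show ?thesis
    by blast
qed

end
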